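(* Let $S_1:X\rightrightarrows Y$ and $S_2:Y\rightrightarrows Z$ be multifunctions between reflexive Banach spaces, and let $\Omega\subset X$ and $\Theta\subset Z$ be closed and convex. Let $S:=S_2\circ S_1:X\rightrightarrows Z$ and define $G:X\times Z\rightrightarrows Y$ by $G(x,z):=S_1(x)\cap S_2^{-1}(z)=\{y\in S_1(x): z\in S_2(y)\}$. Fix $(\bar x,\bar z)\in\operatorname{gph}S|_\Omega^\Theta$ and $\bar y\in G(\bar x,\bar z)$, and suppose that $\operatorname{gph}S_1|_\Omega$ and $\operatorname{gph}S_2|^\Theta$ are closed around $(\bar x,\bar y)$ and $(\bar y,\bar z)$, respectively, and that $G$ is inner semicontinuous relative to $\Omega\times\Theta$ at $(\bar x,\bar z,\bar y)$. Assume that $S_1$ is PSNC relative to $\Omega\times Y$ at $(\bar x,\bar y)$, that $S_2$ is PSNC relative to $Y\times\Theta$ at $(\bar y,\bar z)$, and that the qualification condition $$D_M^*S_2^\Theta(\bar y|\bar z)(0)\cap\ker D_N^*S_{1\Omega}(\bar x|\bar y)=\{0\}$$ holds. Then the composition $S$ is PSNC relative to $\Omega\times\Theta$ at $(\bar x,\bar z)$.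
   Context: Conventions. "Reflexive Banach space" means a reflexive Banach space normed in such a way that both $X$ and $X^*$ are locally uniformly convex. $\rightharpoonup^*$ is weak$^*$ convergence; products carry the Euclidean product norm, e.g. $\|(x,y)\|=\sqrt{\|x\|^2+\|y\|^2}$. A set is closed around one of its points $\bar u$ if its intersection with some closed set containing $\bar u$ in its interior is closed. For $S:X\rightrightarrows Y$, $\Omega\subset X$, $\Theta\subset Y$: $\operatorname{gph}S=\{(x,y): y\in S(x)\}$; $S|_\Omega^\Theta(x)=S(x)\cap\Theta$ if $x\in\Omega$ and $\emptyset$ otherwise; $S|_\Omega=S|_\Omega^Y$; $S|^\Theta=S|_X^\Theta$. $\ker H=\{u: 0\in H(u)\}$. $(S_2\circ S_1)(x)=\bigcup_{y\in S_1(x)}S_2(y)$. Duality mapping: $J_X(x)=\{x^*: \langle x^*,x\rangle=\|x\|^2,\ \|x^*\|=\|x\|\}$; for a set $A$, $J_X(A)=\bigcup_{x\in A}J_X(x)$. Contingent cone at $\bar x\in\Omega$: $T(\bar x;\Omega)=\{z: \exists\, t_k\downarrow0,\ z_k\to z,\ \bar x+t_kz_k\in\Omega\}$. $\varepsilon$-normals at $\bar x\in\Omega$: $\widehat N_\varepsilon(\bar x;\Omega)=\{x^*: \limsup_{x\to\bar x,\,x\in\Omega}\langle x^*,x-\bar x\rangle/\|x-\bar x\|\le\varepsilon\}$. Relative contingent coderivatives. For $S:X\rightrightarrows Y$ and $(\bar x,\bar y)\in\operatorname{gph}S|_\Omega^\Theta$, consider sequences $\varepsilon_k\downarrow0$,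 $(x_k,y_k)\to(\bar x,\bar y)$ with $(x_k,y_k)\in\operatorname{gph}S|_\Omega^\Theta$, and $(x_k^*,y_k^* )$ with $$(x_k^*,-y_k^* )\in\widehat N_{\varepsilon_k}\big((x_k,y_k);\operatorname{gph}S|_\Omega^\Theta\big)\cap\big[J_X(T(x_k;\Omega))\times J_Y(T(y_k;\Theta))\big]\quad\text{for all }k.\qquad( * )$$ $\bar x^*\in D_N^*S_\Omega^\Theta(\bar x|\bar y)(\bar y^* )$ (normal) iff there are such sequences with $x_k^*\rightharpoonup^*\bar x^*$, $y_k^*\rightharpoonup^*\bar y^*$; $\bar x^*\in D_M^*S_\Omega^\Theta(\bar x|\bar y)(\bar y^* )$ (mixed) iff there are such sequences with $x_k^*\rightharpoonup^*\bar x^*$, $y_k^*\to\bar y^*$ in norm. $D^*S_{1\Omega}$ means $D^*(S_1)_\Omega^Y$ (relative to $\Omega\times Y$) and $D^*S_2^\Theta$ means $D^*(S_2)_Y^\Theta$ (relative to $Y\times\Theta$). PSNC: $S$ is PSNC relative to $\Omega\times\Theta$ at $(\bar x,\bar y)\in\operatorname{gph}S|_\Omega^\Theta$ if for all sequences $\varepsilon_k\in(0,1)$, $\varepsilon_k\downarrow0$, $\operatorname{gph}S|_\Omega^\Theta\ni(x_k,y_k)\to(\bar x,\bar y)$, $(x_k^*,y_k^* )$ satisfying $( * )$ with $x_k^*\rightharpoonup^*0$, $y_k^*\to0$, one has $\|x_k^*\|\to0$. Inner semicontinuity: $F:U\rightrightarrows V$ is inner semicontinuous relative to $A\subset U$ at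 $(\bar u,\bar v)\in\operatorname{gph}F|_A$ if for every sequence $u_k\to\bar u$ with $u_k\in A$, $F(u_k)\ne\emptyset$, there are $v_k\in F(u_k)$ converging to $\bar v$. Here $F=G$, $U=X\times Z$, $A=\Omega\times\Theta$. *)

theory Defs
  imports "HOL-Analysis.Analysis"
begin

type_synonym 'a dual = "'a \<Rightarrow>\<^sub>L real"

definition reflexive :: "'a::real_normed_vector itself \<Rightarrow> bool" where
  "reflexive _ \<longleftrightarrow> (\<forall>\<phi> :: 'a dual dual. \<exists>x::'a. \<forall>f :: 'a dual. blinfun_apply \<phi> f = blinfun_apply f x)"

definition locally_uniformly_convex :: "'a::real_normed_vector itself \<Rightarrow> bool" where
  "locally_uniformly_convex _ \<longleftrightarrow>
     (\<forall>x::'a. norm x = 1 \<longrightarrow> (\<forall>\<epsilon>>0. \<exists>\<delta>>0. \<forall>y::'a.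
        norm y = 1 \<and> norm (x - y) \<ge> \<epsilon> \<longrightarrow> norm ((1/2) *\<^sub>R (x + y)) \<le> 1 - \<delta>))"

definition reflexive_banach_space :: "'a::banach itself \<Rightarrow> bool" where
  "reflexive_banach_space _ \<longleftrightarrow> reflexive TYPE('a) \<and>
     locally_uniformly_convex TYPE('a) \<and> locally_uniformly_convex TYPE('a dual)"

definition weak_star_tendsto :: "(nat \<Rightarrow> 'a::real_normed_vector dual) \<Rightarrow> 'a dual \<Rightarrow> bool" where
  "weak_star_tendsto f l \<longleftrightarrow> (\<forall>x. (\<lambda>k. blinfun_apply (f k) x) \<longlonglongrightarrow> blinfun_apply l x)"

text \<open>Identification of a pair of functionals with a functional on the product:
  \<open>(x, y) \<mapsto> \<langle>x*, x\<rangle> + \<langle>y*, y\<rangle>\<close>. The library norm on products is the Euclidean one.\<close>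

definition dual_pair ::
  "'a::real_normed_vector dual \<Rightarrow> 'b::real_normed_vector dual \<Rightarrow> ('a \<times> 'b) dual" where
  "dual_pair xs ys = (xs o\<^sub>L fst_blinfun) + (ys o\<^sub>L snd_blinfun)"

definition closed_around :: "'a::topological_space set \<Rightarrow> 'a \<Rightarrow> bool" where
  "closed_around A u \<longleftrightarrow> u \<in> A \<and> (\<exists>C. closed C \<and> u \<in> interior C \<and> closed (A \<inter> C))"

type_synonym ('a, 'b) multifun = "'a \<Rightarrow> 'b set"

definition gph :: "('a, 'b) multifun \<Rightarrow> ('a \<times> 'b) set" where
  "gph S = {(x, y). y \<in> S x}"

definition mf_restrict :: "('a, 'b) multifun \<Rightarrow> 'a set \<Rightarrow> 'b set \<Rightarrow> ('a, 'b) multifun" where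
  "mf_restrict S \<Omega> \<Theta> = (\<lambda>x. if x \<in> \<Omega> then S x \<inter> \<Theta> else {})"

definition mf_kernel :: "('a, 'b::zero) multifun \<Rightarrow> 'a set" where
  "mf_kernel H = {u. 0 \<in> H u}"

definition mf_comp :: "('b, 'c) multifun \<Rightarrow> ('a, 'b) multifun \<Rightarrow> ('a, 'c) multifun" where
  "mf_comp S2 S1 = (\<lambda>x. \<Union>y\<in>S1 x. S2 y)"

definition mf_inverse :: "('a, 'b) multifun \<Rightarrow> ('b, 'a) multifun" where
  "mf_inverse S = (\<lambda>y. {x. y \<in> S x})"

definition inner_semicontinuous_rel ::
  "('a::topological_space, 'b::topological_space) multifun \<Rightarrow> 'a set \<Rightarrow> 'a \<Rightarrow> 'b \<Rightarrow> bool" where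
  "inner_semicontinuous_rel F A u v \<longleftrightarrow> (u, v) \<in> gph (mf_restrict F A UNIV) \<and>
     (\<forall>us. us \<longlonglongrightarrow> u \<and> (\<forall>k. us k \<in> A \<and> F (us k) \<noteq> {}) \<longrightarrow>
        (\<exists>vs. (\<forall>k. vs k \<in> F (us k)) \<and> vs \<longlonglongrightarrow> v))"

definition duality_map :: "'a::real_normed_vector \<Rightarrow> 'a dual set" where
  "duality_map x = {xs. blinfun_apply xs x = (norm x)\<^sup>2 \<and> norm xs = norm x}"

text \<open>Here and below \<open>t\<^sub>k \<down> 0\<close> means that the sequence is positive and tends to 0;
  passing to subsequences shows that requiring monotonicity would change nothing.\<close>

definition contingent_cone :: "'a::real_normed_vector \<Rightarrow> 'a set \<Rightarrow> 'a set" where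
  "contingent_cone x \<Omega> = {z. x \<in> \<Omega> \<and>
     (\<exists>t zs. (\<forall>k::nat. t k > 0) \<and> t \<longlonglongrightarrow> (0::real) \<and> zs \<longlonglongrightarrow> z \<and>
        (\<forall>k. x + t k *\<^sub>R zs k \<in> \<Omega>))}"

text \<open>The upper limit is taken in the extended reals, so that at an isolated point it is
  \<open>-\<infinity>\<close> and every functional is an \<open>\<epsilon>\<close>-normal.\<close>

definition eps_normals :: "real \<Rightarrow> 'a::real_normed_vector \<Rightarrow> 'a set \<Rightarrow> 'a dual set" where
  "eps_normals \<epsilon> x \<Omega> = {xs. x \<in> \<Omega> \<and>
     Limsup (at x within \<Omega>) (\<lambda>u. ereal (blinfun_apply xs (u - x) / norm (u - x))) \<le> ereal \<epsilon>}"

text \<open>The sequences common to the relative coderivatives and to the PSNC property;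
  \<open>xd\<close> and \<open>yd\<close> are the dual sequences \<open>x\<^sub>k*\<close> and \<open>y\<^sub>k*\<close>.\<close>

definition rel_normal_seqs ::
  "('a::real_normed_vector, 'b::real_normed_vector) multifun \<Rightarrow> 'a set \<Rightarrow> 'b set \<Rightarrow> 'a \<Rightarrow> 'b \<Rightarrow>
   (nat \<Rightarrow> real) \<Rightarrow> (nat \<Rightarrow> 'a) \<Rightarrow> (nat \<Rightarrow> 'b) \<Rightarrow> (nat \<Rightarrow> 'a dual) \<Rightarrow> (nat \<Rightarrow> 'b dual) \<Rightarrow> bool" where
  "rel_normal_seqs S \<Omega> \<Theta> x y \<epsilon> xs ys xd yd \<longleftrightarrow>
     (\<forall>k. \<epsilon> k > 0) \<and> \<epsilon> \<longlonglongrightarrow> 0 \<and>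
     (\<forall>k. (xs k, ys k) \<in> gph (mf_restrict S \<Omega> \<Theta>)) \<and>
     (\<lambda>k. (xs k, ys k)) \<longlonglongrightarrow> (x, y) \<and>
     (\<forall>k. dual_pair (xd k) (- yd k) \<in> eps_normals (\<epsilon> k) (xs k, ys k) (gph (mf_restrict S \<Omega> \<Theta>)) \<and>
          xd k \<in> (\<Union>u\<in>contingent_cone (xs k) \<Omega>. duality_map u) \<and>
          - yd k \<in> (\<Union>v\<in>contingent_cone (ys k) \<Theta>. duality_map v))"

definition normal_coderivative ::
  "('a::real_normed_vector, 'b::real_normed_vector) multifun \<Rightarrow> 'a set \<Rightarrow> 'b set \<Rightarrow> 'a \<Rightarrow> 'b \<Rightarrow>
   ('b dual, 'a dual) multifun" where
  "normal_coderivative S \<Omega> \<Theta> x y = (\<lambda>yd0. {xd0. (x, y) \<in> gph (mf_restrict S \<Omega> \<Theta>) \<and>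
     (\<exists>\<epsilon> xs ys xd yd. rel_normal_seqs S \<Omega> \<Theta> x y \<epsilon> xs ys xd yd \<and>
        weak_star_tendsto xd xd0 \<and> weak_star_tendsto yd yd0)})"

definition mixed_coderivative ::
  "('a::real_normed_vector, 'b::real_normed_vector) multifun \<Rightarrow> 'a set \<Rightarrow> 'b set \<Rightarrow> 'a \<Rightarrow> 'b \<Rightarrow>
   ('b dual, 'a dual) multifun" where
  "mixed_coderivative S \<Omega> \<Theta> x y = (\<lambda>yd0. {xd0. (x, y) \<in> gph (mf_restrict S \<Omega> \<Theta>) \<and>
     (\<exists>\<epsilon> xs ys xd yd. rel_normal_seqs S \<Omega> \<Theta> x y \<epsilon> xs ys xd yd \<and>
        weak_star_tendsto xd xd0 \<and> yd \<longlonglongrightarrow> yd0)})"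

definition PSNC ::
  "('a::real_normed_vector, 'b::real_normed_vector) multifun \<Rightarrow> 'a set \<Rightarrow> 'b set \<Rightarrow> 'a \<Rightarrow> 'b \<Rightarrow> bool" where
  "PSNC S \<Omega> \<Theta> x y \<longleftrightarrow> (x, y) \<in> gph (mf_restrict S \<Omega> \<Theta>) \<and>
     (\<forall>\<epsilon> xs ys xd yd. rel_normal_seqs S \<Omega> \<Theta> x y \<epsilon> xs ys xd yd \<and> (\<forall>k. \<epsilon> k < 1) \<and>
        weak_star_tendsto xd 0 \<and> yd \<longlonglongrightarrow> 0 \<longrightarrow> (\<lambda>k. norm (xd k)) \<longlonglongrightarrow> 0)"

end

theory Submission
  imports Defs "HOL-Library.Diagonal_Subsequence"
begin

text \<open>
  Let \<open>(x\<^sub>k*, - z\<^sub>k*)\<close> be normals to the graph of the composition as in the definition of PSNC, with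
  \<open>x\<^sub>k*\<close> weak* null and \<open>z\<^sub>k*\<close> norm null. Inner semicontinuity supplies intermediate points \<open>y\<^sub>k\<close> tending
  to \<open>y\<close>. The core of the argument is a fuzzy rule (\<open>fuzzy_relcomp_normals\<close>): near \<open>(x\<^sub>k, y\<^sub>k)\<close> and
  \<open>(y\<^sub>k, z\<^sub>k)\<close> there are normals \<open>(u\<^sub>k*, - v\<^sub>k*)\<close> to the graph of the inner map and \<open>(v\<^sub>k*, - w\<^sub>k*)\<close> to the graph
  of the outer map, with \<open>u\<^sub>k*\<close> close to \<open>\<tau>\<^sub>k x\<^sub>k*\<close>, \<open>w\<^sub>k*\<close> close to \<open>\<tau>\<^sub>k z\<^sub>k*\<close> and
  \<open>\<tau>\<^sub>k\<^sup>2 + \<parallel>v\<^sub>k*\<parallel>\<^sup>2 = 1\<close>, all satisfying the constraints by the duality map and the contingent cones.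
  So \<open>u\<^sub>k*\<close> is weak* null and \<open>w\<^sub>k*\<close> norm null, and \<open>v\<^sub>k*\<close> is bounded. Along subsequences \<open>v\<^sub>k*\<close> converges
  weak* by reflexivity; the qualification condition makes the limit \<open>0\<close>, and PSNC of the outer map gives
  \<open>\<parallel>v\<^sub>k*\<parallel> \<rightarrow> 0\<close> (\<open>intermediate_duals_tendsto_zero\<close>). Hence \<open>\<tau>\<^sub>k \<rightarrow> 1\<close>, PSNC of the inner map gives
  \<open>\<parallel>u\<^sub>k*\<parallel> \<rightarrow> 0\<close>, and with it \<open>\<parallel>x\<^sub>k*\<parallel> \<rightarrow> 0\<close>.

  The fuzzy rule comes from the Ekeland principle on the product of the two graphs, applied to
  \<open>sqrt (s\<^sub>+\<^sup>2 + \<parallel>y - y'\<parallel>\<^sup>2)\<close>, where \<open>y, y'\<close> are the two copies of the intermediate variable and \<open>s\<close>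
  replaces the linear form \<open>- x\<^sub>k* + z\<^sub>k*\<close> by quadratic functions \<open>\<parallel>a - x\<parallel>\<^sup>2/(2\<tau>)\<close>, \<open>a \<in> \<Omega>\<close>
  (\<open>tangent_potential\<close>). Their gradients at points of the convex set \<open>\<Omega>\<close> are automatically negatives of
  elements of \<open>J(T(\<cdot>; \<Omega>))\<close>, which is how the relative constraint survives the perturbation. Only two
  facts on the norms are needed: elements of the duality map are subgradients of \<open>\<parallel>\<cdot>\<parallel>\<^sup>2/2\<close>, and the
  duality map is single-valued and continuous because the dual norm is locally uniformly convex.
\<close>

section \<open>The Hahn--Banach theorem\<close>

text \<open>A sublinear functional: subadditive and homogeneous for nonnegative scalars.\<close>

definition sublinear :: "('a::real_vector \<Rightarrow> real) \<Rightarrow> bool" where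
  "sublinear p \<longleftrightarrow> (\<forall>x y. p (x + y) \<le> p x + p y) \<and> (\<forall>c x. 0 \<le> c \<longrightarrow> p (c *\<^sub>R x) = c * p x)"

lemma sublinearI:
  assumes "\<And>x y. p (x + y) \<le> p x + p y" and "\<And>c x. 0 < c \<Longrightarrow> p (c *\<^sub>R x) \<le> c * p x" and "p 0 = 0"
  shows "sublinear p"
proof -
  have "p (c *\<^sub>R x) = c * p x" if "0 \<le> c" for c x
  proof (cases "c = 0")
    case False
    with that have c: "0 < c" by simp
    have "p (inverse c *\<^sub>R (c *\<^sub>R x)) \<le> inverse c * p (c *\<^sub>R x)"
      by (rule assms(2)) (use c in simp)
    then have "c * p x \<le> p (c *\<^sub>R x)" using c by (simp add: field_simps)
    with assms(2)[OF c, of x] show ?thesis by simp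
  qed (simp add: assms(3))
  with assms(1) show ?thesis by (simp add: sublinear_def)
qed

lemma sublinear_add: "sublinear p \<Longrightarrow> p (x + y) \<le> p x + p y"
  and sublinear_scale: "sublinear p \<Longrightarrow> 0 \<le> c \<Longrightarrow> p (c *\<^sub>R x) = c * p x"
  by (auto simp: sublinear_def)

lemma sublinear_zero: "sublinear p \<Longrightarrow> p 0 = 0"
  using sublinear_scale[of p 0 0] by simp

lemma sublinear_minus: "sublinear p \<Longrightarrow> - p (- x) \<le> p x"
  using sublinear_add[of p x "- x"] by (simp add: sublinear_zero)

text \<open>Lowering \<open>p\<close> in the direction \<open>-v\<close>: the witness is
  \<open>q x = (INF t\<ge>0. p (x + t v) - t p v)\<close>, the largest sublinear functional below \<open>p\<close> whose value at
  \<open>-v\<close> is at most \<open>- p v\<close>. If \<open>p\<close> is minimal then \<open>q = p\<close>, which forces \<open>p (-v) = - p v\<close>; so minimal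
  sublinear functionals are linear.\<close>

lemma sublinear_reduce:
  fixes p :: "'a::real_vector \<Rightarrow> real"
  assumes p: "sublinear p"
  obtains q where "sublinear q" and "\<And>x. q x \<le> p x" and "q (- v) \<le> - p v"
proof
  define A where "A x = (\<lambda>t. p (x + t *\<^sub>R v) - t * p v) ` {0..}" for x
  define q where "q x = Inf (A x)" for x
  have low: "- p (- x) \<le> a" if a: "a \<in> A x" for a x
  proof -
    obtain t where t: "0 \<le> t" "a = p (x + t *\<^sub>R v) - t * p v" using a unfolding A_def by auto
    have "t * p v = p (t *\<^sub>R v)" using sublinear_scale[OF p t(1)] by simp
    also have "\<dots> \<le> p (x + t *\<^sub>R v) + p (- x)"
      using sublinear_add[OF p, of "x + t *\<^sub>R v" "- x"] by simp
    finally show ?thesis using t by simp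
  qed
  have bdd: "bdd_below (A x)" for x using low by (meson bdd_belowI)
  have le: "q x \<le> p (x + t *\<^sub>R v) - t * p v" if "0 \<le> t" for x t
    unfolding q_def by (rule cInf_lower[OF _ bdd]) (use that in \<open>auto simp: A_def\<close>)
  have greatest: "m \<le> q x" if "\<And>t. 0 \<le> t \<Longrightarrow> m \<le> p (x + t *\<^sub>R v) - t * p v" for m x
    unfolding q_def by (rule cInf_greatest) (use that in \<open>auto simp: A_def\<close>)
  show "q x \<le> p x" for x using le[of 0 x] by simp
  show "q (- v) \<le> - p v" using le[of 1 "- v"] by (simp add: sublinear_zero[OF p])
  show "sublinear q"
  proof (rule sublinearI)
    fix x y
    have *: "q (x + y) - (p (y + s *\<^sub>R v) - s * p v) \<le> q x" if s: "0 \<le> s" for s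
    proof (rule greatest)
      fix t :: real assume t: "0 \<le> t"
      have "q (x + y) \<le> p ((x + t *\<^sub>R v) + (y + s *\<^sub>R v)) - (t + s) * p v"
        using le[of "t + s" "x + y"] s t by (simp add: algebra_simps)
      then show "q (x + y) - (p (y + s *\<^sub>R v) - s * p v) \<le> p (x + t *\<^sub>R v) - t * p v"
        using sublinear_add[OF p, of "x + t *\<^sub>R v" "y + s *\<^sub>R v"] by (simp add: algebra_simps)
    qed
    have "q (x + y) - q x \<le> q y"
      by (rule greatest) (use * in \<open>force simp: algebra_simps\<close>)
    then show "q (x + y) \<le> q x + q y" by simp
  next
    fix c :: real and x assume c: "0 < c"
    have "q (c *\<^sub>R x) / c \<le> q x"
    proof (rule greatest)
      fix t :: real assume t: "0 \<le> t"
      have "q (c *\<^sub>R x) \<le> p (c *\<^sub>R (x + t *\<^sub>R v)) - (c * t) * p v"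
        using le[of "c * t" "c *\<^sub>R x"] c t by (simp add: algebra_simps)
      also have "\<dots> = c * (p (x + t *\<^sub>R v) - t * p v)"
        using c by (subst sublinear_scale[OF p]) (simp_all add: algebra_simps)
      finally show "q (c *\<^sub>R x) / c \<le> p (x + t *\<^sub>R v) - t * p v"
        using c by (simp add: field_simps)
    qed
    then show "q (c *\<^sub>R x) \<le> c * q x" using c by (simp add: field_simps)
  next
    have "0 \<le> q 0"
      by (rule greatest) (simp add: sublinear_scale[OF p])
    then show "q 0 = 0" using le[of 0 0] by (simp add: sublinear_zero[OF p])
  qed
qed

text \<open>Zorn's lemma for the pointwise order: a chain of sublinear functionals has its pointwise
  infimum as a lower bound, which is finite because \<open>- p (- x)\<close> bounds every member from below at \<open>x\<close>.\<close>

lemma exists_minimal_sublinear: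
  fixes p :: "'a::real_vector \<Rightarrow> real"
  assumes p: "sublinear p"
  obtains m where "sublinear m" and "\<And>x. m x \<le> p x"
    and "\<And>q. sublinear q \<Longrightarrow> (\<And>x. q x \<le> m x) \<Longrightarrow> q = m"
proof -
  define B where "B = {q. sublinear q \<and> (\<forall>x. q x \<le> p x)}"
  define R where "R = (\<lambda>q q' :: 'a \<Rightarrow> real. \<forall>x. q' x \<le> q x)"
  have po: "partial_order_on B (relation_of R B)"
    by (rule partial_order_on_relation_ofI) (auto simp: R_def fun_eq_iff intro: order_trans antisym)
  have "\<exists>u\<in>B. \<forall>a\<in>C. R a u" if C: "C \<in> Chains (relation_of R B)" for C
  proof (cases "C = {}")
    case True
    then show ?thesis using p by (auto simp: B_def)
  next
    case False
    have CB: "C \<subseteq> B" and tot: "\<And>a b. a \<in> C \<Longrightarrow> b \<in> C \<Longrightarrow> R a b \<or> R b a"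
      using C by (auto simp: Chains_def relation_of_def)
    define u where "u x = Inf ((\<lambda>a. a x) ` C)" for x
    have low: "- p (- x) \<le> a x" if "a \<in> C" for a x
    proof -
      have "a (- x) \<le> p (- x)" "sublinear a" using that CB by (auto simp: B_def)
      with sublinear_minus[of a x] show ?thesis by simp
    qed
    have bdd: "bdd_below ((\<lambda>a. a x) ` C)" for x
      by (rule bdd_belowI[of _ "- p (- x)"]) (use low in auto)
    have le: "u x \<le> a x" if "a \<in> C" for a x
      unfolding u_def by (rule cInf_lower[OF _ bdd]) (use that in auto)
    have greatest: "m \<le> u x" if "\<And>a. a \<in> C \<Longrightarrow> m \<le> a x" for m x
      unfolding u_def by (rule cInf_greatest) (use that False in auto)
    have "sublinear u"
    proof (rule sublinearI)
      fix x y
      have *: "u (x + y) \<le> a x + b y" if a: "a \<in> C" and b: "b \<in> C" for a b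
      proof -
        have sa: "sublinear a" and sb: "sublinear b" using a b CB by (auto simp: B_def)
        consider "R a b" | "R b a" using tot[OF a b] by blast
        then show ?thesis
        proof cases
          case 1
          then have "b x \<le> a x" by (simp add: R_def)
          then show ?thesis using le[OF b, of "x + y"] sublinear_add[OF sb, of x y] by simp
        next
          case 2
          then have "a y \<le> b y" by (simp add: R_def)
          then show ?thesis using le[OF a, of "x + y"] sublinear_add[OF sa, of x y] by simp
        qed
      qed
      have "u (x + y) - b y \<le> u x" if "b \<in> C" for b
        by (rule greatest) (use *[OF _ that] in force)
      then have "u (x + y) - u x \<le> u y"
        by (intro greatest) (force simp: algebra_simps)
      then show "u (x + y) \<le> u x + u y" by simp
    next
      fix c :: real and x assume c: "0 < c"
      have "u (c *\<^sub>R x) / c \<le> u x"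
      proof (rule greatest)
        fix a assume a: "a \<in> C"
        then have "sublinear a" using CB by (auto simp: B_def)
        then have "a (c *\<^sub>R x) = c * a x" using c by (simp add: sublinear_scale)
        with le[OF a, of "c *\<^sub>R x"] show "u (c *\<^sub>R x) / c \<le> a x" using c by (simp add: field_simps)
      qed
      then show "u (c *\<^sub>R x) \<le> c * u x" using c by (simp add: field_simps)
    next
      have "a 0 = 0" if "a \<in> C" for a using that CB by (auto simp: B_def sublinear_zero)
      then have "(\<lambda>a. a 0) ` C = {0}" using False by force
      then show "u 0 = 0" by (simp add: u_def)
    qed
    moreover have "u x \<le> p x" for x
    proof -
      obtain a where "a \<in> C" using False by blast
      then show ?thesis using le[of a x] CB by (auto simp: B_def intro: order_trans)
    qed
    ultimately show ?thesis using le by (auto simp: B_def R_def)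
  qed
  from predicate_Zorn[OF po this] obtain m where m: "m \<in> B" "\<And>a. a \<in> B \<Longrightarrow> R m a \<Longrightarrow> a = m"
    by blast
  show ?thesis
  proof (rule that[of m])
    show "sublinear m" "\<And>x. m x \<le> p x" using m(1) by (auto simp: B_def)
    show "q = m" if "sublinear q" "\<And>x. q x \<le> m x" for q
      using that m(1) by (intro m(2)) (auto simp: B_def R_def intro: order_trans)
  qed
qed

text \<open>The Hahn--Banach theorem without partially defined functionals: first lower \<open>p\<close> to have
  value at most \<open>- p w\<close> at \<open>-w\<close>, then pass to a minimal sublinear functional, which is linear.\<close>

theorem hahn_banach_sublinear:
  fixes p :: "'a::real_vector \<Rightarrow> real"
  assumes p: "sublinear p"
  obtains f where "linear f" and "\<And>x. f x \<le> p x" and "f w = p w"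
proof -
  obtain q where q: "sublinear q" "\<And>x. q x \<le> p x" "q (- w) \<le> - p w"
    using sublinear_reduce[OF p, of w] by blast
  obtain f where f: "sublinear f" "\<And>x. f x \<le> q x"
    and min: "\<And>r. sublinear r \<Longrightarrow> (\<And>x. r x \<le> f x) \<Longrightarrow> r = f"
    using exists_minimal_sublinear[OF q(1)] by blast
  have odd: "f (- v) = - f v" for v
  proof -
    obtain r where r: "sublinear r" "\<And>x. r x \<le> f x" "r (- v) \<le> - f v"
      using sublinear_reduce[OF f(1), of v] by blast
    from min[OF r(1,2)] r(3) have "f (- v) \<le> - f v" by simp
    with sublinear_minus[OF f(1), of v] show ?thesis by simp
  qed
  have "linear f"
  proof (rule linearI)
    fix x y
    show "f (x + y) = f x + f y"
      using sublinear_add[OF f(1), of x y] sublinear_add[OF f(1), of "- x" "- y"]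
        odd[of "x + y"] by (simp add: odd)
  next
    fix c x
    show "f (c *\<^sub>R x) = c *\<^sub>R f x"
    proof (cases "0 \<le> c")
      case False
      then have "f ((- c) *\<^sub>R x) = (- c) * f x" by (intro sublinear_scale[OF f(1)]) simp
      then show ?thesis using odd[of "c *\<^sub>R x"] by simp
    qed (simp add: sublinear_scale[OF f(1)])
  qed
  moreover have "f x \<le> p x" for x using f(2) q(2) order_trans by blast
  moreover have "f w = p w"
  proof -
    have "p w \<le> f w" using f(2)[of "- w"] q(3) odd[of w] by simp
    moreover have "f w \<le> p w" using f(2) q(2) order_trans by blast
    ultimately show ?thesis by simp
  qed
  ultimately show ?thesis using that by blast
qed

text \<open>The distance to a subspace is a sublinear functional bounded by the norm, so that norming
  functionals (\<open>W = {0}\<close>) and separating functionals come from the same instance of the previous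
  theorem.\<close>

lemma functional_vanishing_on_subspace:
  fixes W :: "'a::real_normed_vector set"
  assumes W: "subspace W"
  obtains f :: "'a dual" where "norm f \<le> 1" and "\<And>x. x \<in> W \<Longrightarrow> blinfun_apply f x = 0"
    and "blinfun_apply f w = infdist w W"
proof -
  have ne: "W \<noteq> {}" using subspace_0[OF W] by blast
  have near: "\<exists>y\<in>W. dist x y < infdist x W + e" if "e > 0" for x and e :: real
  proof -
    have "Inf ((\<lambda>a. dist x a) ` W) < infdist x W + e" using that ne by (simp add: infdist_notempty)
    then show ?thesis using ne by (subst (asm) cInf_less_iff) (auto intro: bdd_belowI[of _ 0])
  qed
  have "sublinear (\<lambda>x. infdist x W)"
  proof (rule sublinearI)
    fix x y
    show "infdist (x + y) W \<le> infdist x W + infdist y W"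
    proof (rule field_le_epsilon)
      fix e :: real assume "e > 0"
      then obtain a b where a: "a \<in> W" "dist x a < infdist x W + e / 2"
        and b: "b \<in> W" "dist y b < infdist y W + e / 2"
        using near[of "e / 2"] by (metis half_gt_zero)
      have "infdist (x + y) W \<le> dist (x + y) (a + b)"
        by (rule infdist_le) (use a b W subspace_add in blast)
      also have "\<dots> \<le> dist x a + dist y b" by (rule dist_triangle_add)
      finally show "infdist (x + y) W \<le> infdist x W + infdist y W + e" using a b by simp
    qed
  next
    fix c :: real and x :: 'a assume c: "0 < c"
    show "infdist (c *\<^sub>R x) W \<le> c * infdist x W"
    proof (rule field_le_epsilon)
      fix e :: real assume "e > 0"
      then obtain a where a: "a \<in> W" "dist x a < infdist x W + e / c"
        using near[of "e / c"] c by auto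
      have "infdist (c *\<^sub>R x) W \<le> dist (c *\<^sub>R x) (c *\<^sub>R a)"
        by (rule infdist_le) (use a W subspace_scale in blast)
      also have "\<dots> = c * dist x a" using c by (simp add: dist_norm flip: scaleR_diff_right)
      also have "\<dots> \<le> c * (infdist x W + e / c)" using a c by (intro mult_left_mono) auto
      finally show "infdist (c *\<^sub>R x) W \<le> c * infdist x W + e" using c by (simp add: algebra_simps)
    qed
  next
    show "infdist 0 W = 0" using subspace_0[OF W] by simp
  qed
  then obtain g where g: "linear g" "\<And>x. g x \<le> infdist x W" "g w = infdist w W"
    using hahn_banach_sublinear[of "\<lambda>x. infdist x W" w] by blast
  have le: "g x \<le> norm x" for x
    using g(2)[of x] infdist_le[OF subspace_0[OF W], of x] by simp
  have abs: "\<bar>g x\<bar> \<le> norm x" for x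
    using le[of x] le[of "- x"] linear_neg[OF g(1), of x] by simp
  have bl: "bounded_linear g"
    by (rule bounded_linear_intro[of _ 1])
      (use abs linear_add[OF g(1)] linear_scale[OF g(1)] in auto)
  show ?thesis
  proof (rule that[of "Blinfun g"])
    show "norm (Blinfun g) \<le> 1"
      by (rule norm_blinfun_bound) (use abs bl in \<open>auto simp: bounded_linear_Blinfun_apply\<close>)
    show "blinfun_apply (Blinfun g) x = 0" if "x \<in> W" for x
    proof -
      have "g x \<le> 0" "g (- x) \<le> 0"
        using g(2)[of x] g(2)[of "- x"] that subspace_neg[OF W that] by auto
      then show ?thesis using bl linear_neg[OF g(1), of x] by (simp add: bounded_linear_Blinfun_apply)
    qed
    show "blinfun_apply (Blinfun g) w = infdist w W"
      using bl g(3) by (simp add: bounded_linear_Blinfun_apply)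
  qed
qed

corollary separating_functional:
  fixes W :: "'a::real_normed_vector set"
  assumes W: "subspace W" and w: "w \<notin> closure W"
  obtains f :: "'a dual" where "\<And>x. x \<in> W \<Longrightarrow> blinfun_apply f x = 0" and "blinfun_apply f w \<noteq> 0"
proof -
  have "infdist w W \<noteq> 0" using in_closure_iff_infdist_zero[of W w] w subspace_0[OF W] by blast
  with functional_vanishing_on_subspace[OF W, of w] that show ?thesis by metis
qed

corollary norming_functional:
  fixes w :: "'a::real_normed_vector"
  obtains f :: "'a dual" where "norm f \<le> 1" and "blinfun_apply f w = norm w"
proof -
  obtain f :: "'a dual" where "norm f \<le> 1" "blinfun_apply f w = infdist w {0}"
    using functional_vanishing_on_subspace[of "{0}" w] subspace_single_0 by metis
  then show ?thesis using that by simp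
qed

section \<open>The duality map\<close>

lemma duality_map_nonempty: "duality_map (x :: 'a::real_normed_vector) \<noteq> {}"
proof -
  obtain f :: "'a dual" where f: "norm f \<le> 1" "blinfun_apply f x = norm x"
    by (rule norming_functional)
  have "norm (norm x *\<^sub>R f) = norm x"
  proof (cases "x = 0")
    case False
    have "norm x \<le> norm f * norm x" using norm_blinfun[of f x] f by simp
    with False f(1) have "norm f = 1" by simp
    then show ?thesis by simp
  qed simp
  then have "norm x *\<^sub>R f \<in> duality_map x"
    by (simp add: duality_map_def f scaleR_blinfun.rep_eq power2_eq_square)
  then show ?thesis by blast
qed

lemma duality_map_scaleR:
  assumes "xs \<in> duality_map x" shows "c *\<^sub>R xs \<in> duality_map (c *\<^sub>R x)"
  using assms by (simp add: duality_map_def scaleR_blinfun.rep_eq blinfun.scaleR_right power2_eq_square)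

lemma blinfun_apply_le_norm: "blinfun_apply f x \<le> norm f * norm x" for f :: "'a::real_normed_vector dual"
  using norm_blinfun[of f x] by simp

lemma duality_map_subgradient:
  assumes "xs \<in> duality_map x"
  shows "(norm x)\<^sup>2 / 2 + blinfun_apply xs (y - x) \<le> (norm y)\<^sup>2 / 2"
proof -
  have "blinfun_apply xs y \<le> norm x * norm y"
    using blinfun_apply_le_norm[of xs y] assms by (simp add: duality_map_def)
  moreover have "2 * (norm x * norm y) \<le> (norm x)\<^sup>2 + (norm y)\<^sup>2"
    using sum_squares_bound[of "norm x" "norm y"] by simp
  moreover have "blinfun_apply xs (y - x) = blinfun_apply xs y - (norm x)\<^sup>2"
    using assms by (simp add: duality_map_def blinfun.diff_right)
  ultimately show ?thesis by (simp add: field_simps)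
qed

text \<open>A quantitative form of Shmulyan's criterion: local uniform convexity of the dual norm makes
  the duality map continuous on the unit sphere. If \<open>y\<close> is close to \<open>x\<close>, then the mean of the two
  norming functionals almost attains \<open>1\<close> at \<open>x\<close>, so they cannot be far apart.\<close>

lemma duality_map_close:
  fixes x :: "'a::real_normed_vector"
  assumes luc: "locally_uniformly_convex TYPE('a dual)"
    and x: "norm x = 1" "f \<in> duality_map x" and e: "e > 0"
  shows "\<exists>d>0. \<forall>y g. norm y = 1 \<and> norm (x - y) < d \<and> g \<in> duality_map y \<longrightarrow> norm (f - g) < e"
proof -
  have f: "norm f = 1" "blinfun_apply f x = 1" using x by (simp_all add: duality_map_def)
  obtain d where d: "d > 0"
    and D: "\<And>g. norm g = 1 \<Longrightarrow> norm (f - g) \<ge> e \<Longrightarrow> norm ((1/2) *\<^sub>R (f + g)) \<le> 1 - d"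
    using luc f e unfolding locally_uniformly_convex_def by blast
  show ?thesis
  proof (intro exI[of _ "2 * d"] conjI allI impI)
    fix y g assume *: "norm y = 1 \<and> norm (x - y) < 2 * d \<and> g \<in> duality_map y"
    then have g: "norm g = 1" "blinfun_apply g y = 1" by (simp_all add: duality_map_def)
    show "norm (f - g) < e"
    proof (rule ccontr)
      assume "\<not> norm (f - g) < e"
      with D g have "norm ((1/2) *\<^sub>R (f + g)) \<le> 1 - d" by simp
      moreover have "blinfun_apply ((1/2) *\<^sub>R (f + g)) x \<le> norm ((1/2) *\<^sub>R (f + g))"
        using blinfun_apply_le_norm[of "(1/2) *\<^sub>R (f + g)" x] x by simp
      moreover have "blinfun_apply ((1/2) *\<^sub>R (f + g)) x = (1/2) * (2 - blinfun_apply g (y - x))"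
        by (simp add: scaleR_blinfun.rep_eq plus_blinfun.rep_eq blinfun.diff_right f g)
      moreover have "blinfun_apply g (y - x) \<le> norm (x - y)"
        using blinfun_apply_le_norm[of g "y - x"] g by (simp add: norm_minus_commute)
      ultimately show False using * by simp
    qed
  qed (use d in simp)
qed

text \<open>A selection of the duality map; when the dual norm is locally uniformly convex it is the only
  one.\<close>

definition duality_sel :: "'a::real_normed_vector \<Rightarrow> 'a dual" where
  "duality_sel x = (SOME xs. xs \<in> duality_map x)"

lemma duality_sel: "duality_sel x \<in> duality_map x"
  unfolding duality_sel_def using duality_map_nonempty[of x] by (simp add: some_in_eq)

lemma norm_duality_sel [simp]: "norm (duality_sel x) = norm x"
  using duality_sel[of x] by (simp add: duality_map_def)

lemma duality_sel_0 [simp]: "duality_sel 0 = 0"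
  by (metis norm_duality_sel norm_eq_zero)

lemma duality_map_unique:
  fixes x :: "'a::real_normed_vector"
  assumes luc: "locally_uniformly_convex TYPE('a dual)" and f: "f \<in> duality_map x"
  shows "f = duality_sel x"
proof (cases "x = 0")
  case True
  then have "norm f = 0" using f by (simp add: duality_map_def)
  with True show ?thesis by simp
next
  case False
  define c where "c = inverse (norm x)"
  have "norm (c *\<^sub>R f - c *\<^sub>R duality_sel x) \<le> 0 + e" if "e > 0" for e
  proof -
    have "norm (c *\<^sub>R x) = 1" using False by (simp add: c_def)
    from duality_map_close[OF luc this duality_map_scaleR[OF f] that] obtain d where "d > 0"
      and d: "\<And>y g. norm y = 1 \<Longrightarrow> norm (c *\<^sub>R x - y) < d \<Longrightarrow> g \<in> duality_map y \<Longrightarrow> norm (c *\<^sub>R f - g) < e"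
      by blast
    have "norm (c *\<^sub>R f - c *\<^sub>R duality_sel x) < e"
      by (rule d[OF \<open>norm (c *\<^sub>R x) = 1\<close> _ duality_map_scaleR[OF duality_sel]]) (use \<open>d > 0\<close> in simp)
    then show ?thesis by simp
  qed
  then have "norm (c *\<^sub>R f - c *\<^sub>R duality_sel x) \<le> 0" by (rule field_le_epsilon)
  then show ?thesis using False by (simp add: c_def)
qed

lemma duality_sel_scaleR:
  fixes x :: "'a::real_normed_vector"
  assumes luc: "locally_uniformly_convex TYPE('a dual)"
  shows "duality_sel (c *\<^sub>R x) = c *\<^sub>R duality_sel x"
  by (rule duality_map_unique[OF luc duality_map_scaleR[OF duality_sel], symmetric])

lemma isCont_duality_sel:
  fixes x :: "'a::real_normed_vector"
  assumes luc: "locally_uniformly_convex TYPE('a dual)"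
  shows "isCont (duality_sel :: 'a \<Rightarrow> 'a dual) x"
proof (cases "x = 0")
  case True
  have "((\<lambda>y::'a. norm (duality_sel y)) \<longlongrightarrow> 0) (at 0)"
    by (simp add: tendsto_norm_zero)
  then have "((\<lambda>y::'a. duality_sel y) \<longlongrightarrow> 0) (at 0)" by (rule tendsto_norm_zero_cancel)
  then show ?thesis using True by (simp add: isCont_def)
next
  case False
  have sgn: "((\<lambda>y. sgn y) \<longlongrightarrow> sgn x) (at x)" by (intro tendsto_sgn False) simp
  have "((\<lambda>y. duality_sel (sgn y)) \<longlongrightarrow> duality_sel (sgn x)) (at x)"
  proof (rule tendstoI)
    fix e :: real assume e: "e > 0"
    have "norm (sgn x) = 1" using False by (simp add: norm_sgn)
    from duality_map_close[OF luc this duality_sel e] obtain d where d: "d > 0"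
      "\<And>y g. norm y = 1 \<Longrightarrow> norm (sgn x - y) < d \<Longrightarrow> g \<in> duality_map y \<Longrightarrow> norm (duality_sel (sgn x) - g) < e"
      by blast
    have "eventually (\<lambda>y. dist (sgn y) (sgn x) < d) (at x)" using sgn d(1) by (rule tendstoD)
    moreover have "eventually (\<lambda>y. y \<noteq> 0) (at x)"
      using False tendsto_imp_eventually_ne[OF tendsto_ident_at] by blast
    ultimately show "eventually (\<lambda>y. dist (duality_sel (sgn y)) (duality_sel (sgn x)) < e) (at x)"
    proof eventually_elim
      case (elim y)
      then have "norm (duality_sel (sgn x) - duality_sel (sgn y)) < e"
        by (intro d(2)[OF _ _ duality_sel]) (simp_all add: norm_sgn dist_norm norm_minus_commute)
      then show ?case by (simp add: dist_norm norm_minus_commute)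
    qed
  qed
  then have "((\<lambda>y. norm y *\<^sub>R duality_sel (sgn y)) \<longlongrightarrow> norm x *\<^sub>R duality_sel (sgn x)) (at x)"
    by (intro tendsto_intros) auto
  moreover have "norm y *\<^sub>R duality_sel (sgn y) = duality_sel y" for y :: 'a
    proof -
    have "norm y *\<^sub>R sgn y = y" by (cases "y = 0") (simp_all add: sgn_div_norm)
    then show ?thesis using duality_sel_scaleR[OF luc, of "norm y" "sgn y"] by simp
  qed
  ultimately show ?thesis by (simp add: isCont_def)
qed

section \<open>Weak* sequential compactness in duals of reflexive spaces\<close>

text \<open>In a reflexive space, points of the space itself separate functionals from closed subspaces
  of the dual.\<close>

lemma reflexive_separating_point:
  fixes M :: "'a::real_normed_vector dual set"
  assumes refl: "reflexive TYPE('a)" and M: "subspace M" and w: "w \<notin> closure M"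
  obtains y :: 'a where "\<And>m. m \<in> M \<Longrightarrow> blinfun_apply m y = 0" and "blinfun_apply w y \<noteq> 0"
proof -
  obtain \<phi> :: "'a dual dual" where "\<And>m. m \<in> M \<Longrightarrow> blinfun_apply \<phi> m = 0" "blinfun_apply \<phi> w \<noteq> 0"
    using separating_functional[OF M w] by blast
  moreover obtain y where "\<And>f. blinfun_apply \<phi> f = blinfun_apply f y"
    using refl unfolding reflexive_def by blast
  ultimately show ?thesis using that by metis
qed

lemma half_norming_point:
  fixes f :: "'a::real_normed_vector dual"
  obtains x where "norm x \<le> 1" and "norm f / 2 \<le> \<bar>blinfun_apply f x\<bar>"
proof (cases "f = 0")
  case True
  then show ?thesis using that[of 0] by simp
next
  case False
  have "\<exists>x. norm x \<le> 1 \<and> norm f / 2 \<le> \<bar>blinfun_apply f x\<bar>"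
  proof (rule ccontr)
    assume "\<not> ?thesis"
    then have less: "\<And>x. norm x \<le> 1 \<Longrightarrow> \<bar>blinfun_apply f x\<bar> < norm f / 2" by force
    have "norm f \<le> norm f / 2"
    proof (rule norm_blinfun_bound)
      fix x
      have "\<bar>blinfun_apply f (sgn x)\<bar> \<le> norm f / 2"
        using less_imp_le[OF less[of "sgn x"]] by (auto simp: norm_sgn)
      then show "norm (blinfun_apply f x) \<le> norm f / 2 * norm x"
        by (cases "x = 0") (simp_all add: sgn_div_norm blinfun.scaleR_right abs_mult field_simps)
    qed simp
    then show False using False by simp
  qed
  with that show ?thesis by blast
qed

lemma convergent_subseq_on_countable:
  fixes v :: "nat \<Rightarrow> 'a::real_normed_vector dual" and y :: "nat \<Rightarrow> 'a"
  assumes B: "\<And>k. norm (v k) \<le> B"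
  obtains r :: "nat \<Rightarrow> nat" where "strict_mono r"
    and "\<And>m. convergent (\<lambda>k. blinfun_apply (v (r k)) (y m))"
proof -
  interpret subseqs "\<lambda>m s. convergent (\<lambda>k. blinfun_apply (v (s k)) (y m))"
  proof
    fix m and s :: "nat \<Rightarrow> nat" assume "strict_mono s"
    have "norm (blinfun_apply (v (s k)) (y m)) \<le> B * norm (y m)" for k
      using norm_blinfun[of "v (s k)" "y m"] mult_right_mono[OF B norm_ge_zero, of "s k" "y m"] by simp
    then have "bounded (range (\<lambda>k. blinfun_apply (v (s k)) (y m)))"
      by (auto simp: bounded_iff)
    from bounded_imp_convergent_subsequence[OF this]
    show "\<exists>r'. strict_mono r' \<and> convergent (\<lambda>k. blinfun_apply (v ((s \<circ> r') k)) (y m))"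
      by (auto simp: convergent_def o_def)
  qed
  show ?thesis
  proof (rule that[OF subseq_diagseq])
    fix m
    define c where "c = (\<lambda>k. blinfun_apply (v (diagseq k)) (y m))"
    have "convergent (\<lambda>k. blinfun_apply (v ((diagseq \<circ> (+) (Suc m)) k)) (y m))"
    proof (rule diagseq_holds)
      fix r s :: "nat \<Rightarrow> nat" and n assume "strict_mono r" "convergent (\<lambda>k. blinfun_apply (v (s k)) (y n))"
      then show "convergent (\<lambda>k. blinfun_apply (v ((s \<circ> r) k)) (y n))"
        using convergent_subseq_convergent[of "\<lambda>k. blinfun_apply (v (s k)) (y n)" r] by (simp add: o_def)
    qed
    then have "convergent (\<lambda>k. c (k + Suc m))" by (simp add: c_def o_def add.commute)
    then show "convergent (\<lambda>k. blinfun_apply (v (diagseq k)) (y m))"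
      using convergent_ignore_initial_segment[of c "Suc m"] by (simp add: c_def)
  qed
qed

text \<open>Bounded sequences in the dual of a reflexive space have weak* convergent subsequences. A
  subsequence is chosen to converge on a countable set of points that almost norm the rational
  combinations of its terms. Let \<open>C\<close> be the closed subspace of points where it converges. A functional
  \<open>w\<close> vanishing on \<open>C\<close> vanishes on the common kernel of the sequence, so by reflexivity it lies in
  the closed span \<open>M\<close> of the sequence; vanishing on the norming points, it is \<open>0\<close>. Hence \<open>C\<close> is the
  whole space.\<close>

theorem reflexive_weak_star_subsequence:
  fixes v :: "nat \<Rightarrow> 'a::real_normed_vector dual"
  assumes refl: "reflexive TYPE('a)" and B: "\<And>k. norm (v k) \<le> B"
  obtains r :: "nat \<Rightarrow> nat" and l where "strict_mono r" and "weak_star_tendsto (\<lambda>k. v (r k)) l"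
proof -
  define comb :: "(rat \<times> nat) list \<Rightarrow> 'a dual"
    where "comb = (\<lambda>l. sum_list (map (\<lambda>(q, i). real_of_rat q *\<^sub>R v i) l))"
  define M where "M = closure (range comb)"
  have comb_append: "comb (l @ l') = comb l + comb l'" for l l' by (simp add: comb_def)
  have comb_scale: "comb (map (\<lambda>(p, i). (q * p, i)) l) = real_of_rat q *\<^sub>R comb l" for q l
    by (induction l) (auto simp: comb_def of_rat_mult algebra_simps)
  have comb0: "comb [] = 0" by (simp add: comb_def)
  have M_lim: "a \<in> M" if "\<And>n. s n \<in> range comb" "s \<longlonglongrightarrow> a" for s a
    unfolding M_def closure_sequential using that by (intro exI[of _ s]) simp
  have M: "subspace M"
  proof (rule subspaceI)
    show "0 \<in> M" using closure_subset[of "range comb"] rangeI[of comb "[]"] unfolding M_def comb0 by (rule subsetD)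
  next
    fix a b assume "a \<in> M" "b \<in> M"
    then obtain s t where s: "\<And>n. s n \<in> range comb" "s \<longlonglongrightarrow> a" and t: "\<And>n. t n \<in> range comb" "t \<longlonglongrightarrow> b"
      unfolding M_def closure_sequential by blast
    have "s n + t n \<in> range comb" for n
    proof -
      obtain l where "s n = comb l" using s(1)[of n] by (rule rangeE)
      moreover obtain l' where "t n = comb l'" using t(1)[of n] by (rule rangeE)
      ultimately have "s n + t n = comb (l @ l')" by (simp add: comb_append)
      then show ?thesis by simp
    qed
    from M_lim[OF this tendsto_add[OF s(2) t(2)]] show "a + b \<in> M" .
  next
    fix c :: real and a assume "a \<in> M"
    then obtain s where s: "\<And>n. s n \<in> range comb" "s \<longlonglongrightarrow> a"
      unfolding M_def closure_sequential by blast
    have "\<exists>q. dist (real_of_rat q) c < inverse (real (Suc n))" for n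
    proof -
      obtain q where "c < real_of_rat q" "real_of_rat q < c + inverse (real (Suc n))"
        using of_rat_dense[of c "c + inverse (real (Suc n))"] by auto
      then show ?thesis by (intro exI[of _ q]) (simp add: dist_real_def)
    qed
    then obtain q where q: "\<And>n. dist (real_of_rat (q n)) c < inverse (real (Suc n))" by metis
    have "(\<lambda>n. real_of_rat (q n)) \<longlonglongrightarrow> c"
    proof (rule metric_tendsto_imp_tendsto[OF LIMSEQ_inverse_real_of_nat])
      show "\<forall>\<^sub>F n in sequentially. dist (real_of_rat (q n)) c \<le> dist (inverse (real (Suc n))) 0"
        using q by (intro always_eventually allI) (simp add: less_imp_le)
    qed
    then have lim: "(\<lambda>n. real_of_rat (q n) *\<^sub>R s n) \<longlonglongrightarrow> c *\<^sub>R a" using s(2) by (rule tendsto_scaleR)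
    have "real_of_rat (q n) *\<^sub>R s n \<in> range comb" for n
    proof -
      obtain l where "s n = comb l" using s(1)[of n] by (rule rangeE)
      then have "real_of_rat (q n) *\<^sub>R s n = comb (map (\<lambda>(p, i). (q n * p, i)) l)"
        by (simp add: comb_scale)
      then show ?thesis by (simp only: rangeI)
    qed
    from M_lim[OF this lim] show "c *\<^sub>R a \<in> M" .
  qed
  have vM: "v k \<in> M" for k
  proof -
    have "v k = comb [(1, k)]" by (simp add: comb_def)
    then show ?thesis using closure_subset[of "range comb"] rangeI[of comb "[(1, k)]"] unfolding M_def by auto
  qed
  define e where "e l = (SOME x. norm x \<le> 1 \<and> norm (comb l) / 2 \<le> \<bar>blinfun_apply (comb l) x\<bar>)" for l
  have "\<exists>x. norm x \<le> 1 \<and> norm (comb l) / 2 \<le> \<bar>blinfun_apply (comb l) x\<bar>" for l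
    by (rule half_norming_point[of "comb l"]) blast
  from someI_ex[OF this] have e: "norm (e l) \<le> 1" "norm (comb l) / 2 \<le> \<bar>blinfun_apply (comb l) (e l)\<bar>" for l
    by (simp_all add: e_def)
  obtain r where r: "strict_mono r" "\<And>m. convergent (\<lambda>k. blinfun_apply (v (r k)) (e (from_nat m)))"
    using convergent_subseq_on_countable[where v = v and y = "\<lambda>m. e (from_nat m)", OF B] by blast
  define C where "C = {x. convergent (\<lambda>k. blinfun_apply (v (r k)) x)}"
  have eC: "e l \<in> C" for l using r(2)[of "to_nat l"] by (simp add: C_def)
  have C: "subspace C"
  proof (rule subspaceI)
    show "0 \<in> C" by (simp add: C_def convergent_const)
    show "a + b \<in> C" if "a \<in> C" "b \<in> C" for a b
      using that by (simp add: C_def blinfun.add_right convergent_add)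
    show "c *\<^sub>R a \<in> C" if "a \<in> C" for c a
      using that convergent_mult[OF convergent_const] by (simp add: C_def blinfun.scaleR_right)
  qed
  have closed: "closure C \<subseteq> C"
  proof
    fix x assume x: "x \<in> closure C"
    have "B \<ge> 0" using norm_ge_zero order_trans B by blast
    have "Cauchy (\<lambda>k. blinfun_apply (v (r k)) x)"
    proof (rule metric_CauchyI)
      fix \<epsilon> :: real assume "\<epsilon> > 0"
      define \<delta> where "\<delta> = \<epsilon> / (4 * (B + 1))"
      have "\<delta> > 0" using \<open>\<epsilon> > 0\<close> \<open>B \<ge> 0\<close> by (simp add: \<delta>_def)
      then obtain x' where x': "x' \<in> C" "dist x' x < \<delta>" using x closure_approachable by blast
      have near: "\<bar>blinfun_apply (v k) x - blinfun_apply (v k) x'\<bar> \<le> \<epsilon> / 4" for k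
      proof -
        have "\<bar>blinfun_apply (v k) (x - x')\<bar> \<le> norm (v k) * norm (x - x')"
          using norm_blinfun[of "v k" "x - x'"] by simp
        also have "\<dots> \<le> (B + 1) * \<delta>"
          using B[of k] x' \<open>B \<ge> 0\<close> by (intro mult_mono) (auto simp: dist_norm norm_minus_commute)
        also have "\<dots> = \<epsilon> / 4" using \<open>B \<ge> 0\<close> by (simp add: \<delta>_def field_simps)
        finally show ?thesis by (simp add: blinfun.diff_right)
      qed
      have "Cauchy (\<lambda>k. blinfun_apply (v (r k)) x')" using x'(1) by (simp add: C_def convergent_Cauchy)
      then obtain N where N: "\<And>m n. m \<ge> N \<Longrightarrow> n \<ge> N \<Longrightarrow>
          dist (blinfun_apply (v (r m)) x') (blinfun_apply (v (r n)) x') < \<epsilon> / 4"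
        using \<open>\<epsilon> > 0\<close> by (meson metric_CauchyD divide_pos_pos zero_less_numeral)
      have "dist (blinfun_apply (v (r m)) x) (blinfun_apply (v (r n)) x) < \<epsilon>" if "m \<ge> N" "n \<ge> N" for m n
        using N[OF that] near[of "r m"] near[of "r n"] unfolding dist_real_def by linarith
      then show "\<exists>N. \<forall>m\<ge>N. \<forall>n\<ge>N. dist (blinfun_apply (v (r m)) x) (blinfun_apply (v (r n)) x) < \<epsilon>"
        by blast
    qed
    then show "x \<in> C" by (simp add: C_def Cauchy_convergent_iff)
  qed
  have conv: "convergent (\<lambda>k. blinfun_apply (v (r k)) x)" for x
  proof (rule ccontr)
    assume "\<not> convergent (\<lambda>k. blinfun_apply (v (r k)) x)"
    then have "x \<notin> closure C" using closed by (auto simp: C_def)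
    then obtain w :: "'a dual" where w: "\<And>y. y \<in> C \<Longrightarrow> blinfun_apply w y = 0" "blinfun_apply w x \<noteq> 0"
      using separating_functional[OF C] by blast
    have "w \<in> closure M"
    proof (rule ccontr)
      assume "w \<notin> closure M"
      from reflexive_separating_point[OF refl M this] obtain y
        where y: "\<And>m. m \<in> M \<Longrightarrow> blinfun_apply m y = 0" "blinfun_apply w y \<noteq> 0" by blast
      have "y \<in> C" using y(1)[OF vM] by (simp add: C_def convergent_const)
      with w y show False by simp
    qed
    then have wM: "w \<in> closure (range comb)" by (simp add: M_def)
    have "norm w \<le> 0 + \<epsilon>" if "\<epsilon> > 0" for \<epsilon>
    proof -
      have "\<epsilon> / 3 > 0" using \<open>\<epsilon> > 0\<close> by simp
      then obtain l where l: "dist (comb l) w < \<epsilon> / 3"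
        using wM unfolding closure_approachable by blast
      have "norm (comb l) / 2 \<le> \<bar>blinfun_apply (comb l - w) (e l)\<bar>"
        using e(2)[of l] w(1)[OF eC, of l] by (simp add: minus_blinfun.rep_eq)
      also have "\<dots> \<le> norm (comb l - w) * norm (e l)"
        using norm_blinfun[of "comb l - w" "e l"] by simp
      also have "\<dots> \<le> norm (comb l - w) * 1" by (intro mult_left_mono e(1)) simp
      finally have "norm (comb l) \<le> 2 * dist (comb l) w" by (simp add: dist_norm)
      moreover have "norm w \<le> norm (comb l) + dist (comb l) w"
        using norm_triangle_ineq4[of "comb l" "comb l - w"] by (simp add: dist_norm)
      ultimately show ?thesis using l by simp
    qed
    then have "norm w \<le> 0" by (rule field_le_epsilon)
    then show False using w(2) by simp
  qed
  define l where "l x = lim (\<lambda>k. blinfun_apply (v (r k)) x)" for x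
  have l: "(\<lambda>k. blinfun_apply (v (r k)) x) \<longlonglongrightarrow> l x" for x
    using conv[of x] by (simp add: l_def convergent_LIMSEQ_iff)
  have "bounded_linear l"
  proof (rule bounded_linear_intro[of _ B])
    show "l (x + y) = l x + l y" for x y
      using l[of "x + y"] tendsto_add[OF l[of x] l[of y]]
      by (simp add: blinfun.add_right LIMSEQ_unique)
    show "l (c *\<^sub>R x) = c *\<^sub>R l x" for c x
      using l[of "c *\<^sub>R x"] tendsto_scaleR[OF tendsto_const[of c] l[of x]]
      by (simp add: blinfun.scaleR_right LIMSEQ_unique)
    show "norm (l x) \<le> norm x * B" for x
    proof (rule LIMSEQ_le_const2[OF tendsto_norm[OF l]])
      show "\<exists>N. \<forall>k\<ge>N. norm (blinfun_apply (v (r k)) x) \<le> norm x * B"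
        using order_trans[OF norm_blinfun mult_right_mono[OF B norm_ge_zero]] by (metis mult.commute)
    qed
  qed
  then have "weak_star_tendsto (\<lambda>k. v (r k)) (Blinfun l)"
    using l by (simp add: weak_star_tendsto_def bounded_linear_Blinfun_apply)
  with r(1) that show ?thesis by blast
qed

section \<open>Ekeland's variational principle\<close>

text \<open>Ekeland's variational principle on a closed subset of a complete space. The point \<open>x\<close> is the
  limit of a sequence that descends along the sets \<open>B x\<close> of points at least as good as \<open>x\<close> after
  paying for the distance, each step almost attaining the infimum of \<open>f\<close> over the current set.\<close>

lemma ekeland:
  fixes f :: "'a::complete_space \<Rightarrow> real"
  assumes M: "closed M" and cont: "continuous_on M f" and nonneg: "\<And>x. x \<in> M \<Longrightarrow> 0 \<le> f x"
    and c: "c > 0" and a: "a \<in> M"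
  obtains x where "x \<in> M" and "f x + c * dist x a \<le> f a"
    and "\<And>y. y \<in> M \<Longrightarrow> f x \<le> f y + c * dist x y"
proof -
  define B where "B x = {y \<in> M. f y + c * dist x y \<le> f x}" for x
  have self: "x \<in> B x" if "x \<in> M" for x using that by (simp add: B_def)
  have BM: "B x \<subseteq> M" for x by (auto simp: B_def)
  have trans: "B y \<subseteq> B x" if "y \<in> B x" for x y
  proof
    fix w assume "w \<in> B y"
    moreover have "c * dist x w \<le> c * dist x y + c * dist y w"
      using c by (simp add: dist_triangle flip: distrib_left)
    ultimately show "w \<in> B x" using that by (auto simp: B_def)
  qed
  have closed_B: "closed (B x)" for x
    unfolding B_def
    by (intro continuous_on_closed_Collect_le continuous_intros cont M)
  have bdd: "bdd_below (f ` B x)" for x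
    by (rule bdd_belowI[of _ 0]) (use nonneg BM in auto)
  have ex: "\<exists>y. y \<in> B x \<and> (\<forall>w\<in>B x. f y \<le> f w + (1/2) ^ n)" if xM: "x \<in> M" for x and n :: nat
  proof -
    have "Inf (f ` B x) < Inf (f ` B x) + (1/2) ^ n" by simp
    then obtain y where y: "y \<in> B x" "f y < Inf (f ` B x) + (1/2) ^ n"
      using self[OF xM] bdd by (subst (asm) cInf_less_iff) auto
    have "Inf (f ` B x) \<le> f w" if "w \<in> B x" for w using bdd that by (intro cInf_lower) auto
    with y show ?thesis by force
  qed
  define F where "F n x = (SOME y. y \<in> B x \<and> (\<forall>w\<in>B x. f y \<le> f w + (1/2) ^ n))" for n :: nat and x
  have F: "F n x \<in> B x" "\<And>w. w \<in> B x \<Longrightarrow> f (F n x) \<le> f w + (1/2) ^ n" if "x \<in> M" for n x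
    using someI_ex[OF ex[OF that, of n]] by (simp_all add: F_def)
  define u where "u = rec_nat a F"
  have u0: "u 0 = a" and uS: "u (Suc n) = F n (u n)" for n by (simp_all add: u_def)
  have uM: "u n \<in> M" for n
    by (induction n) (use a F(1) BM in \<open>auto simp: u0 uS\<close>)
  have chain: "u n \<in> B (u m)" if "m \<le> n" for m n
    using that
  proof (induction n rule: dec_induct)
    case base then show ?case using self uM by blast
  next
    case (step n) then show ?case using trans F(1)[OF uM] uS by (metis subsetD)
  qed
  have small: "c * dist x y \<le> (1/2) ^ n" if "x \<in> B (u (Suc n))" "y \<in> B x" for x y n
  proof -
    have "y \<in> B (u (Suc n))" using that trans by blast
    then have "y \<in> B (u n)" using trans[OF chain[of n "Suc n"]] by auto
    then have "f (u (Suc n)) \<le> f y + (1/2) ^ n" using F(2)[OF uM, of y n n] by (simp add: uS)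
    moreover have "0 \<le> c * dist (u (Suc n)) x" using c by simp
    ultimately show ?thesis using that by (simp add: B_def)
  qed
  have "Cauchy u"
  proof (rule metric_CauchyI)
    fix e :: real assume "e > 0"
    then obtain N where N: "(1/2::real) ^ N < c * e / 2"
      using real_arch_pow_inv[of "c * e / 2" "1/2"] c by auto
    have *: "dist (u (Suc N)) (u n) < e / 2" if "Suc N \<le> n" for n
    proof -
      have "c * dist (u (Suc N)) (u n) \<le> (1/2) ^ N"
        by (rule small) (use that uM self chain in auto)
      with N have "c * dist (u (Suc N)) (u n) < c * (e / 2)" by simp
      then show ?thesis using c by simp
    qed
    show "\<exists>N. \<forall>m\<ge>N. \<forall>n\<ge>N. dist (u m) (u n) < e"
      by (rule exI[of _ "Suc N"]) (use * in \<open>blast intro: dist_triangle_half_r\<close>)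
  qed
  then obtain x where x: "u \<longlonglongrightarrow> x" using Cauchy_convergent convergent_def by blast
  have xB: "x \<in> B (u n)" for n
    by (rule Lim_in_closed_set[OF closed_B _ _ x])
      (use chain in \<open>auto simp: eventually_sequentially\<close>)
  have uniq: "y = x" if "y \<in> B x" for y
  proof -
    have "c * dist x y \<le> 0 + e" if e: "e > 0" for e
    proof -
      obtain N where "(1/2::real) ^ N < e" using real_arch_pow_inv[of e "1/2"] e by auto
      then show ?thesis using small[OF xB \<open>y \<in> B x\<close>, of N] by simp
    qed
    then have "c * dist x y \<le> 0" by (rule field_le_epsilon)
    then show ?thesis using c by (simp add: mult_le_0_iff)
  qed
  show ?thesis
  proof (rule that)
    show "x \<in> M" using xB BM by blast
    show "f x + c * dist x a \<le> f a" using xB[of 0] by (simp add: u0 B_def dist_commute)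
    show "f x \<le> f y + c * dist x y" if "y \<in> M" for y
    proof (cases "f y + c * dist x y \<le> f x")
      case True
      with that uniq[of y] show ?thesis by (simp add: B_def)
    qed simp
  qed
qed

section \<open>Normals and contingent cones\<close>

lemma dual_pair_apply [simp]: "blinfun_apply (dual_pair f g) w = blinfun_apply f (fst w) + blinfun_apply g (snd w)"
  by (simp add: dual_pair_def plus_blinfun.rep_eq fst_blinfun.rep_eq snd_blinfun.rep_eq)

text \<open>The upper limit written with \<open>\<epsilon>\<close>s and \<open>\<delta>\<close>s; multiplying by the norm makes \<open>u = x\<close> harmless.\<close>

lemma eps_normals_iff:
  "xs \<in> eps_normals \<epsilon> x A \<longleftrightarrow> x \<in> A \<and>
     (\<forall>\<gamma>>0. \<exists>d>0. \<forall>u\<in>A. dist u x < d \<longrightarrow> blinfun_apply xs (u - x) \<le> (\<epsilon> + \<gamma>) * norm (u - x))"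
    (is "_ \<longleftrightarrow> _ \<and> ?R")
proof -
  let ?q = "\<lambda>u. blinfun_apply xs (u - x) / norm (u - x)"
  have "Limsup (at x within A) (\<lambda>u. ereal (?q u)) \<le> ereal \<epsilon> \<longleftrightarrow>
      (\<forall>y>ereal \<epsilon>. eventually (\<lambda>u. ereal (?q u) < y) (at x within A))"
    by (rule Limsup_le_iff)
  also have "\<dots> \<longleftrightarrow> (\<forall>\<gamma>>0. eventually (\<lambda>u. ?q u \<le> \<epsilon> + \<gamma>) (at x within A))"
  proof (intro iffI allI impI)
    fix \<gamma> :: real assume L: "\<forall>y>ereal \<epsilon>. eventually (\<lambda>u. ereal (?q u) < y) (at x within A)" and "\<gamma> > 0"
    with L[rule_format, of "ereal (\<epsilon> + \<gamma>)"] have "eventually (\<lambda>u. ereal (?q u) < ereal (\<epsilon> + \<gamma>)) (at x within A)" by simp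
    then show "eventually (\<lambda>u. ?q u \<le> \<epsilon> + \<gamma>) (at x within A)" by (rule eventually_mono) simp
  next
    fix y assume R: "\<forall>\<gamma>>0. eventually (\<lambda>u. ?q u \<le> \<epsilon> + \<gamma>) (at x within A)" and y: "ereal \<epsilon> < y"
    obtain z where z: "ereal \<epsilon> < ereal z" "ereal z < y" using ereal_dense2[OF y] by blast
    then have "eventually (\<lambda>u. ?q u \<le> \<epsilon> + (z - \<epsilon>)) (at x within A)"
      by (intro R[rule_format]) simp
    then show "eventually (\<lambda>u. ereal (?q u) < y) (at x within A)"
      by (rule eventually_mono) (use z in \<open>auto intro: le_less_trans[of _ "ereal z"]\<close>)
  qed
  also have "\<dots> \<longleftrightarrow> ?R"
  proof (intro all_cong1 imp_cong refl)
    fix \<gamma> :: real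
    have "(u \<noteq> x \<and> dist u x < d \<longrightarrow> ?q u \<le> \<epsilon> + \<gamma>) \<longleftrightarrow>
        (dist u x < d \<longrightarrow> blinfun_apply xs (u - x) \<le> (\<epsilon> + \<gamma>) * norm (u - x))" for u d
      by (cases "u = x") (simp_all add: divide_le_eq)
    then show "eventually (\<lambda>u. ?q u \<le> \<epsilon> + \<gamma>) (at x within A) \<longleftrightarrow>
      (\<exists>d>0. \<forall>u\<in>A. dist u x < d \<longrightarrow> blinfun_apply xs (u - x) \<le> (\<epsilon> + \<gamma>) * norm (u - x))"
      unfolding eventually_at by simp
  qed
  finally show ?thesis by (simp add: eps_normals_def)
qed

lemma eps_normals_Times:
  assumes "dual_pair f g \<in> eps_normals \<epsilon> (a, b) (A \<times> B)"
  shows "f \<in> eps_normals \<epsilon> a A" and "g \<in> eps_normals \<epsilon> b B"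
proof -
  have ab: "a \<in> A" "b \<in> B" using assms by (simp_all add: eps_normals_iff)
  have E: "\<exists>d>0. \<forall>u\<in>A \<times> B. dist u (a, b) < d \<longrightarrow>
      blinfun_apply (dual_pair f g) (u - (a, b)) \<le> (\<epsilon> + \<gamma>) * norm (u - (a, b))" if "\<gamma> > 0" for \<gamma>
    using assms that by (simp add: eps_normals_iff)
  show "f \<in> eps_normals \<epsilon> a A" unfolding eps_normals_iff
  proof (intro conjI ab allI impI)
    fix \<gamma> :: real assume "\<gamma> > 0"
    from E[OF this] obtain d where d: "d > 0" "\<And>u. u \<in> A \<times> B \<Longrightarrow> dist u (a, b) < d \<Longrightarrow>
      blinfun_apply (dual_pair f g) (u - (a, b)) \<le> (\<epsilon> + \<gamma>) * norm (u - (a, b))" by blast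
    show "\<exists>d>0. \<forall>u\<in>A. dist u a < d \<longrightarrow> blinfun_apply f (u - a) \<le> (\<epsilon> + \<gamma>) * norm (u - a)"
      using d(1) d(2)[of "(_, b)"] ab by (intro exI[of _ d]) (simp add: dist_Pair_Pair norm_Pair)
  qed
  show "g \<in> eps_normals \<epsilon> b B" unfolding eps_normals_iff
  proof (intro conjI ab allI impI)
    fix \<gamma> :: real assume "\<gamma> > 0"
    from E[OF this] obtain d where d: "d > 0" "\<And>u. u \<in> A \<times> B \<Longrightarrow> dist u (a, b) < d \<Longrightarrow>
      blinfun_apply (dual_pair f g) (u - (a, b)) \<le> (\<epsilon> + \<gamma>) * norm (u - (a, b))" by blast
    show "\<exists>d>0. \<forall>u\<in>B. dist u b < d \<longrightarrow> blinfun_apply g (u - b) \<le> (\<epsilon> + \<gamma>) * norm (u - b)"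
      using d(1) d(2)[of "(a, _)"] ab by (intro exI[of _ d]) (simp add: dist_Pair_Pair norm_Pair)
  qed
qed

lemma contingent_cone_UNIV [simp]: "contingent_cone x UNIV = UNIV"
proof -
  have "z \<in> contingent_cone x UNIV" for z
    unfolding contingent_cone_def using LIMSEQ_inverse_real_of_nat
    by (auto intro!: exI[of _ "\<lambda>n. inverse (real (Suc n))"] exI[of _ "\<lambda>_. z"])
  then show ?thesis by blast
qed

lemma contingent_cone_scaleR:
  assumes z: "z \<in> contingent_cone x \<Omega>" and c: "c \<ge> 0"
  shows "c *\<^sub>R z \<in> contingent_cone x \<Omega>"
proof -
  obtain t zs where t: "x \<in> \<Omega>" "\<And>k. t k > 0" "t \<longlonglongrightarrow> 0" "zs \<longlonglongrightarrow> z" "\<And>k. x + t k *\<^sub>R zs k \<in> \<Omega>"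
    using z unfolding contingent_cone_def by blast
  show ?thesis
  proof (cases "c = 0")
    case True
    then show ?thesis unfolding contingent_cone_def
      by (intro CollectI conjI exI[of _ t] exI[of _ "\<lambda>_. 0"]) (use t in simp_all)
  next
    case False
    with c have c: "c > 0" by simp
    have "(\<lambda>k. t k / c) \<longlonglongrightarrow> 0" using tendsto_divide[OF t(3) tendsto_const, of c] c by simp
    moreover have "(\<lambda>k. c *\<^sub>R zs k) \<longlonglongrightarrow> c *\<^sub>R z" by (intro tendsto_intros t)
    moreover have "\<forall>k. x + (t k / c) *\<^sub>R (c *\<^sub>R zs k) \<in> \<Omega>" using t(5) c by simp
    moreover have "\<forall>k. t k / c > 0" using t(2) c by simp
    ultimately show ?thesis unfolding contingent_cone_def
      by (intro CollectI conjI t(1) exI[of _ "\<lambda>k. t k / c"] exI[of _ "\<lambda>k. c *\<^sub>R zs k"])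
  qed
qed

lemma convex_diff_in_contingent_cone:
  assumes "convex \<Omega>" and x: "x \<in> \<Omega>" and a: "a \<in> \<Omega>"
  shows "a - x \<in> contingent_cone x \<Omega>"
proof -
  have "x + inverse (real (Suc n)) *\<^sub>R (a - x) \<in> \<Omega>" for n
  proof -
    have "(1 - inverse (real (Suc n))) *\<^sub>R x + inverse (real (Suc n)) *\<^sub>R a \<in> \<Omega>"
      using assms by (intro convexD) (auto simp: field_simps)
    then show ?thesis by (simp add: algebra_simps)
  qed
  then show ?thesis unfolding contingent_cone_def using LIMSEQ_inverse_real_of_nat x
    by (auto intro!: exI[of _ "\<lambda>n. inverse (real (Suc n))"] exI[of _ "\<lambda>_. a - x"])
qed

text \<open>The construction that keeps dual elements inside \<open>J(T(\<cdot>; \<Omega>))\<close>. An element of \<open>J(T(x; \<Omega>))\<close> is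
  nearly \<open>J((a - x)/\<tau>)\<close> for some \<open>a \<in> \<Omega>\<close>, \<open>\<tau> > 0\<close>. The convex function \<open>\<phi> u = \<parallel>a - u\<parallel>\<^sup>2/(2\<tau>)\<close> has the
  subgradient \<open>- g u\<close> with \<open>g u = J((a - u)/\<tau>)\<close>, and since \<open>\<Omega>\<close> is convex, \<open>(a - u)/\<tau>\<close> is tangent to
  \<open>\<Omega>\<close> at every \<open>u \<in> \<Omega>\<close>, not only at \<open>x\<close>.\<close>

lemma tangent_potential:
  fixes \<Omega> :: "'a::real_normed_vector set"
  assumes luc: "locally_uniformly_convex TYPE('a dual)" and \<Omega>: "convex \<Omega>"
    and xs: "xs \<in> (\<Union>u\<in>contingent_cone x \<Omega>. duality_map u)" and \<eta>: "\<eta> > 0"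
  obtains \<phi> :: "'a \<Rightarrow> real" and g :: "'a \<Rightarrow> 'a dual" and d :: real
  where "continuous_on UNIV \<phi>" and "\<And>u. isCont g u"
    and "\<And>u w. \<phi> u - blinfun_apply (g u) (w - u) \<le> \<phi> w"
    and "\<And>u. u \<in> \<Omega> \<Longrightarrow> g u \<in> (\<Union>v\<in>contingent_cone u \<Omega>. duality_map v)"
    and "d > 0" and "\<And>u. dist u x \<le> d \<Longrightarrow> norm (g u - xs) \<le> \<eta>"
proof -
  obtain p where p: "p \<in> contingent_cone x \<Omega>" "xs \<in> duality_map p" using xs by blast
  have xs_eq: "xs = duality_sel p" using duality_map_unique[OF luc p(2)] .
  obtain \<rho> where \<rho>: "\<rho> > 0" "\<And>p'. dist p' p < \<rho> \<Longrightarrow> dist (duality_sel p') (duality_sel p) < \<eta>"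
    using isCont_duality_sel[OF luc, of p] \<eta> unfolding continuous_at_eps_delta by blast
  obtain t zs where t: "x \<in> \<Omega>" "\<And>k. t k > 0" "t \<longlonglongrightarrow> 0" "zs \<longlonglongrightarrow> p" "\<And>k::nat. x + t k *\<^sub>R zs k \<in> \<Omega>"
    using p(1) unfolding contingent_cone_def by blast
  obtain k where k: "dist (zs k) p < \<rho> / 2"
    using t(4) \<rho>(1) by (meson LIMSEQ_def half_gt_zero order_refl)
  define \<tau> where "\<tau> = t k"
  define a where "a = x + \<tau> *\<^sub>R zs k"
  have \<tau>: "\<tau> > 0" and a: "a \<in> \<Omega>" using t by (simp_all add: \<tau>_def a_def)
  define \<phi> where "\<phi> u = (norm (a - u))\<^sup>2 / 2 / \<tau>" for u
  define g where "g u = inverse \<tau> *\<^sub>R duality_sel (a - u)" for u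
  have g_eq: "g u = duality_sel (inverse \<tau> *\<^sub>R (a - u))" for u
    by (simp add: g_def duality_sel_scaleR[OF luc])
  show ?thesis
  proof (rule that[of \<phi> g "\<tau> * \<rho> / 3"])
    show "continuous_on UNIV \<phi>" unfolding \<phi>_def using \<tau> by (intro continuous_intros) auto
    show "isCont g u" for u
      unfolding g_def by (intro continuous_intros isCont_o2[OF _ isCont_duality_sel[OF luc]])
    show "\<phi> u - blinfun_apply (g u) (w - u) \<le> \<phi> w" for u w
    proof -
      have "(norm (a - u))\<^sup>2 / 2 - blinfun_apply (duality_sel (a - u)) (w - u) \<le> (norm (a - w))\<^sup>2 / 2"
        using duality_map_subgradient[OF duality_sel[of "a - u"], of "a - w"]
        by (simp add: blinfun.diff_right)
      then have "((norm (a - u))\<^sup>2 / 2 - blinfun_apply (duality_sel (a - u)) (w - u)) / \<tau> \<le> (norm (a - w))\<^sup>2 / 2 / \<tau>"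
        using \<tau> by (intro divide_right_mono) auto
      then show ?thesis unfolding \<phi>_def g_def scaleR_blinfun.rep_eq using \<tau> by (simp add: field_simps)
    qed
    show "g u \<in> (\<Union>v\<in>contingent_cone u \<Omega>. duality_map v)" if "u \<in> \<Omega>" for u
    proof -
      have "inverse \<tau> *\<^sub>R (a - u) \<in> contingent_cone u \<Omega>"
        using \<tau> by (intro contingent_cone_scaleR convex_diff_in_contingent_cone \<Omega> a that) simp
      then show ?thesis unfolding g_eq using duality_sel by blast
    qed
    show "\<tau> * \<rho> / 3 > 0" using \<tau> \<rho>(1) by simp
    show "norm (g u - xs) \<le> \<eta>" if u: "dist u x \<le> \<tau> * \<rho> / 3" for u
    proof -
      have "inverse \<tau> *\<^sub>R (a - u) - p = inverse \<tau> *\<^sub>R (x - u) + (zs k - p)"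
        using \<tau> by (simp add: a_def algebra_simps)
      then have "dist (inverse \<tau> *\<^sub>R (a - u)) p \<le> norm (inverse \<tau> *\<^sub>R (x - u)) + dist (zs k) p"
        unfolding dist_norm using norm_triangle_ineq by metis
      also have "norm (inverse \<tau> *\<^sub>R (x - u)) = inverse \<tau> * dist u x"
        using \<tau> by (simp add: dist_norm norm_minus_commute)
      also have "inverse \<tau> * dist u x \<le> \<rho> / 3" using u \<tau> by (simp add: field_simps)
      finally have "dist (inverse \<tau> *\<^sub>R (a - u)) p < \<rho>" using k \<rho>(1) by simp
      from \<rho>(2)[OF this] show ?thesis unfolding g_eq xs_eq by (simp add: dist_norm)
    qed
  qed
qed

section \<open>A fuzzy rule for normals to composed graphs\<close>

lemma eps_normals_mono:
  assumes "xs \<in> eps_normals \<epsilon> x A" and "\<epsilon> \<le> \<epsilon>'"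
  shows "xs \<in> eps_normals \<epsilon>' x A"
  using assms by (auto simp: eps_normals_def intro: order_trans)

lemma isCont_dual_pair:
  assumes "isCont f a" and "isCont g a"
  shows "isCont (\<lambda>w. dual_pair (f w) (g w)) a"
  unfolding dual_pair_def using assms
  by (intro continuous_intros bounded_bilinear.continuous[OF bounded_bilinear_blinfun_compose]) auto

lemma pos_part_square_diff:
  fixes s t :: real
  shows "(max s 0)\<^sup>2 - (max t 0)\<^sup>2 \<le> 2 * max s 0 * (s - t)"
proof (cases "s \<le> 0")
  case False
  have "0 \<le> (s - t)\<^sup>2" and "t < 0 \<Longrightarrow> s * t \<le> 0" using False by (auto simp: mult_le_0_iff)
  then show ?thesis using False by (cases "t < 0") (auto simp: power2_eq_square algebra_simps max_def)
qed simp

text \<open>First-order condition at a minimizer of \<open>F = sqrt (s\<^sub>+\<^sup>2 + 2q)\<close>, up to an error \<open>\<rho>\<close> times the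
  distance. The functions \<open>s\<close> and \<open>q\<close> enter only through upper estimates of their increments by
  continuous families of functionals \<open>H\<close>, \<open>G\<close> taken at the moving point \<open>w\<close>, as subgradients of convex
  functions provide; \<open>s\<close> may in addition have a part with Lipschitz constant \<open>\<kappa>\<close>, which only enlarges
  the \<open>\<epsilon>\<close> of the normal.\<close>

lemma penalty_minimizer_normal:
  fixes s q :: "'w::real_normed_vector \<Rightarrow> real" and H G :: "'w \<Rightarrow> 'w dual"
  defines "F \<equiv> \<lambda>w. sqrt ((max (s w) 0)\<^sup>2 + 2 * q w)"
  assumes s: "\<And>w. s w - s a \<le> blinfun_apply (H w) (w - a) + \<kappa> * norm (w - a)"
    and cont: "isCont s a" "isCont H a" "isCont G a"
    and q: "\<And>w. q w - q a \<le> blinfun_apply (G w) (w - a)" and q0: "\<And>w. 0 \<le> q w"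
    and a: "a \<in> A" and F0: "F a > 0" and r: "r > 0"
    and min: "\<And>w. w \<in> A \<Longrightarrow> dist w a < r \<Longrightarrow> F a \<le> F w + \<rho> * dist w a"
  shows "- (inverse (F a) *\<^sub>R (max (s a) 0 *\<^sub>R H a + G a)) \<in> eps_normals (\<kappa> * (max (s a) 0 / F a) + \<rho>) a A"
  unfolding eps_normals_iff
proof (intro conjI a allI impI)
  fix \<gamma> :: real assume \<gamma>: "\<gamma> > 0"
  define K where "K w = max (s w) 0 *\<^sub>R H w + G w" for w
  define e where "e = \<gamma> * F a / 2"
  have e: "e > 0" using \<gamma> F0 by (simp add: e_def)
  have "isCont K a" unfolding K_def by (intro continuous_intros cont continuous_max)
  then obtain d1 where d1: "d1 > 0" "\<And>w. dist w a < d1 \<Longrightarrow> dist (K w) (K a) < e"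
    using e unfolding continuous_at_eps_delta by blast
  have "isCont (\<lambda>w. \<kappa> * max (s w) 0) a" by (intro continuous_intros cont continuous_max)
  then obtain d2 where d2: "d2 > 0" "\<And>w. dist w a < d2 \<Longrightarrow> dist (\<kappa> * max (s w) 0) (\<kappa> * max (s a) 0) < e"
    using e unfolding continuous_at_eps_delta by blast
  show "\<exists>d>0. \<forall>w\<in>A. dist w a < d \<longrightarrow>
      blinfun_apply (- (inverse (F a) *\<^sub>R (max (s a) 0 *\<^sub>R H a + G a))) (w - a)
      \<le> (\<kappa> * (max (s a) 0 / F a) + \<rho> + \<gamma>) * norm (w - a)"
  proof (intro exI[of _ "min r (min d1 d2)"] conjI ballI impI)
    fix w assume w: "w \<in> A" "dist w a < min r (min d1 d2)"
    define n where "n = norm (w - a)"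
    have n: "n \<ge> 0" "dist w a = n" by (simp_all add: n_def dist_norm)
    have Fsq: "(F v)\<^sup>2 = (max (s v) 0)\<^sup>2 + 2 * q v" for v
      unfolding F_def using q0[of v] by simp
    have "2 * F a * (F a - F w) \<le> 2 * F a * (\<rho> * n)"
      using min[OF w(1)] w(2) F0 n by (intro mult_left_mono) auto
    moreover have "2 * F a * (F w - F a) \<le> (F w)\<^sup>2 - (F a)\<^sup>2"
      using zero_le_power2[of "F w - F a"] by (simp add: power2_eq_square algebra_simps)
    ultimately have "- (2 * F a * (\<rho> * n)) \<le> (F w)\<^sup>2 - (F a)\<^sup>2" by (simp add: algebra_simps)
    also have "\<dots> \<le> 2 * max (s w) 0 * (s w - s a) + 2 * blinfun_apply (G w) (w - a)"
      unfolding Fsq using pos_part_square_diff[of "s w" "s a"] q[of w] by simp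
    also have "\<dots> \<le> 2 * max (s w) 0 * (blinfun_apply (H w) (w - a) + \<kappa> * n) + 2 * blinfun_apply (G w) (w - a)"
      unfolding n_def by (intro add_right_mono mult_left_mono s) simp
    also have "\<dots> = 2 * (blinfun_apply (K w) (w - a) + \<kappa> * max (s w) 0 * n)"
      by (simp add: K_def plus_blinfun.rep_eq scaleR_blinfun.rep_eq algebra_simps)
    finally have "- (F a * (\<rho> * n)) \<le> blinfun_apply (K w) (w - a) + \<kappa> * max (s w) 0 * n" by simp
    moreover have "\<kappa> * max (s w) 0 * n \<le> (\<kappa> * max (s a) 0 + e) * n"
      using d2(2)[of w] w n by (intro mult_right_mono) (auto simp: dist_real_def)
    moreover have "blinfun_apply (K w) (w - a) \<le> blinfun_apply (K a) (w - a) + e * n"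
    proof -
      have "blinfun_apply (K w - K a) (w - a) \<le> norm (K w - K a) * n"
        using blinfun_apply_le_norm by (simp add: n_def)
      also have "\<dots> \<le> e * n" using d1(2)[of w] w n by (intro mult_right_mono) (auto simp: dist_norm)
      finally show ?thesis by (simp add: minus_blinfun.rep_eq)
    qed
    ultimately have "- blinfun_apply (K a) (w - a) \<le> (\<kappa> * max (s a) 0 + F a * \<rho> + F a * \<gamma>) * n"
      by (simp add: e_def algebra_simps)
    then have "inverse (F a) * (- blinfun_apply (K a) (w - a))
        \<le> inverse (F a) * ((\<kappa> * max (s a) 0 + F a * \<rho> + F a * \<gamma>) * n)"
      using F0 by (intro mult_left_mono) auto
    also have "\<dots> = (\<kappa> * (max (s a) 0 / F a) + \<rho> + \<gamma>) * n" using F0 by (simp add: field_simps)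
    finally show "blinfun_apply (- (inverse (F a) *\<^sub>R (max (s a) 0 *\<^sub>R H a + G a))) (w - a)
      \<le> (\<kappa> * (max (s a) 0 / F a) + \<rho> + \<gamma>) * norm (w - a)"
      by (simp add: K_def n_def uminus_blinfun.rep_eq scaleR_blinfun.rep_eq)
  qed (use r d1 d2 in simp)
qed

lemma norm_outer_le: "norm (fst (fst w), snd (snd w)) \<le> norm w"
  for w :: "('x::real_normed_vector \<times> 'y::real_normed_vector) \<times> ('y \<times> 'z::real_normed_vector)"
  by (simp add: norm_prod_def)

text \<open>Fuzzy rule for normals to a composition of graphs. An \<open>\<epsilon>\<close>-normal to \<open>A1 O A2\<close> splits, after
  multiplication by some \<open>\<tau> \<ge> 0\<close> and up to small errors, into normals to \<open>A1\<close> and \<open>A2\<close> at nearby points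
  that share the intermediate functional \<open>vs\<close>. The multiplier may degenerate, but the pair
  \<open>(\<tau>, vs)\<close> has norm \<open>1\<close>, so not both parts vanish. The new functionals
  obey the same constraints by the duality map and the contingent cones; for the intermediate space
  the cone is the whole space, and the constraint is membership in the range of the duality map.\<close>

theorem fuzzy_relcomp_normals:
  fixes A1 :: "('x::banach \<times> 'y::banach) set" and A2 :: "('y \<times> 'z::banach) set"
  assumes luc: "locally_uniformly_convex TYPE('x dual)" "locally_uniformly_convex TYPE('y dual)"
      "locally_uniformly_convex TYPE('z dual)"
    and \<Omega>: "convex \<Omega>" "A1 \<subseteq> \<Omega> \<times> UNIV" and \<Theta>: "convex \<Theta>" "A2 \<subseteq> UNIV \<times> \<Theta>"
    and A1: "(x, y) \<in> A1" "closed (A1 \<inter> C1)" "(x, y) \<in> interior C1"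
    and A2: "(y, z) \<in> A2" "closed (A2 \<inter> C2)" "(y, z) \<in> interior C2"
    and N: "dual_pair xd (- zd) \<in> eps_normals \<epsilon> (x, z) (A1 O A2)" and \<epsilon>: "\<epsilon> \<ge> 0"
    and xd: "xd \<in> (\<Union>u\<in>contingent_cone x \<Omega>. duality_map u)"
    and zd: "- zd \<in> (\<Union>u\<in>contingent_cone z \<Theta>. duality_map u)"
    and \<eta>: "\<eta> > 0"
  shows "\<exists>\<tau> x' y1 y2 z' us vs zs. 0 \<le> \<tau> \<and> \<tau>\<^sup>2 + (norm vs)\<^sup>2 = 1 \<and>
    (x', y1) \<in> A1 \<and> dist (x', y1) (x, y) \<le> \<eta> \<and> (y2, z') \<in> A2 \<and> dist (y2, z') (y, z) \<le> \<eta> \<and>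
    dual_pair us (- vs) \<in> eps_normals (\<epsilon> + 4 * \<eta>) (x', y1) A1 \<and>
    dual_pair vs (- zs) \<in> eps_normals (\<epsilon> + 4 * \<eta>) (y2, z') A2 \<and>
    us \<in> (\<Union>u\<in>contingent_cone x' \<Omega>. duality_map u) \<and>
    - zs \<in> (\<Union>u\<in>contingent_cone z' \<Theta>. duality_map u) \<and>
    vs \<in> range duality_sel \<and> - vs \<in> range duality_sel \<and>
    norm (us - \<tau> *\<^sub>R xd) \<le> \<eta> \<and> norm (zs - \<tau> *\<^sub>R zd) \<le> \<eta>"
proof -
  obtain \<phi> g d1 where \<phi>: "continuous_on UNIV \<phi>" "\<And>u. isCont g u"
      "\<And>u w. \<phi> u - blinfun_apply (g u) (w - u) \<le> \<phi> w"
      "\<And>u. u \<in> \<Omega> \<Longrightarrow> g u \<in> (\<Union>v\<in>contingent_cone u \<Omega>. duality_map v)"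
      "d1 > 0" "\<And>u. dist u x \<le> d1 \<Longrightarrow> norm (g u - xd) \<le> \<eta>"
    by (rule tangent_potential[OF luc(1) \<Omega>(1) xd \<eta>]) blast
  obtain \<psi> h d2 where \<psi>: "continuous_on UNIV \<psi>" "\<And>u. isCont h u"
      "\<And>u w. \<psi> u - blinfun_apply (h u) (w - u) \<le> \<psi> w"
      "\<And>u. u \<in> \<Theta> \<Longrightarrow> h u \<in> (\<Union>v\<in>contingent_cone u \<Theta>. duality_map v)"
      "d2 > 0" "\<And>u. dist u z \<le> d2 \<Longrightarrow> norm (h u - (- zd)) \<le> \<eta>"
    by (rule tangent_potential[OF luc(3) \<Theta>(1) zd \<eta>]) blast
  \<comment> \<open>The slope \<open>\<epsilon> + \<eta>\<close> from the normality of \<open>(xd, - zd)\<close>, and \<open>\<eta>\<close> for each of the replacements of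
    \<open>xd\<close> by \<open>g x\<close> and of \<open>- zd\<close> by \<open>h z\<close>.\<close>
  define \<kappa> where "\<kappa> = \<epsilon> + 3 * \<eta>"
  have \<kappa>: "\<kappa> \<ge> 0" using \<epsilon> \<eta> by (simp add: \<kappa>_def)
  have "\<exists>d>0. \<forall>u\<in>A1 O A2. dist u (x, z) < d \<longrightarrow>
      blinfun_apply (dual_pair xd (- zd)) (u - (x, z)) \<le> (\<epsilon> + \<eta>) * norm (u - (x, z))"
    using N \<eta> unfolding eps_normals_iff by blast
  then obtain d3 where d3: "d3 > 0" "\<And>u. u \<in> A1 O A2 \<Longrightarrow> dist u (x, z) < d3 \<Longrightarrow>
      blinfun_apply (dual_pair xd (- zd)) (u - (x, z)) \<le> (\<epsilon> + \<eta>) * norm (u - (x, z))"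
    by blast
  obtain r1 where r1: "r1 > 0" "ball (x, y) r1 \<subseteq> C1" using A1(3) by (auto simp: mem_interior)
  obtain r2 where r2: "r2 > 0" "ball (y, z) r2 \<subseteq> C2" using A2(3) by (auto simp: mem_interior)
  \<comment> \<open>Half of the admissible radius: the minimizer lies within \<open>\<rho>\<close> of the reference point, and a further
    ball of radius \<open>\<rho>\<close> around it is needed to stay inside \<open>C1 \<times> C2\<close>.\<close>
  define \<rho> where "\<rho> = Min {r1, r2, d1, d2, d3, \<eta>} / 2"
  have "Min {r1, r2, d1, d2, d3, \<eta>} > 0" using r1 r2 \<phi>(5) \<psi>(5) d3(1) \<eta> by simp
  then have \<rho>: "\<rho> > 0" "2 * \<rho> \<le> r1" "2 * \<rho> \<le> r2" "\<rho> \<le> d1" "\<rho> \<le> d2" "\<rho> < d3" "\<rho> \<le> \<eta>"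
    unfolding \<rho>_def by auto

  \<comment> \<open>By the normality of \<open>(xd, - zd)\<close>, the function \<open>s\<close> is at least \<open>\<rho>\<^sup>2\<close> at the points of \<open>A1 \<times> A2\<close>
    near the reference point \<open>P\<close> where \<open>gap\<close> vanishes. So \<open>F\<close> is positive there, while \<open>F P = \<rho>\<^sup>2\<close> is small; the Ekeland
    principle moves \<open>P\<close> by at most \<open>\<rho>\<close>.\<close>
  define outer :: "('x \<times> 'y) \<times> ('y \<times> 'z) \<Rightarrow> 'x \<times> 'z" where "outer w = (fst (fst w), snd (snd w))" for w
  define gap :: "('x \<times> 'y) \<times> ('y \<times> 'z) \<Rightarrow> 'y" where "gap w = snd (fst w) - fst (snd w)" for w
  define s where "s w = \<phi> (fst (fst w)) + \<psi> (snd (snd w)) - (\<phi> x + \<psi> z) + \<kappa> * norm (outer w - (x, z)) + \<rho>\<^sup>2"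
    for w :: "('x \<times> 'y) \<times> ('y \<times> 'z)"
  define q where "q w = (norm (gap w))\<^sup>2 / 2" for w
  define H :: "('x \<times> 'y) \<times> ('y \<times> 'z) \<Rightarrow> (('x \<times> 'y) \<times> ('y \<times> 'z)) dual" where "H w = dual_pair (dual_pair (- g (fst (fst w))) 0) (dual_pair 0 (- h (snd (snd w))))" for w
  define G :: "('x \<times> 'y) \<times> ('y \<times> 'z) \<Rightarrow> (('x \<times> 'y) \<times> ('y \<times> 'z)) dual" where "G w = dual_pair (dual_pair 0 (duality_sel (gap w))) (dual_pair (- duality_sel (gap w)) 0)" for w
  define F where "F w = sqrt ((max (s w) 0)\<^sup>2 + 2 * q w)" for w
  define M where "M = (A1 \<inter> C1) \<times> (A2 \<inter> C2)"
  define P where "P = ((x, y), (y, z))"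

  have contg: "continuous_on UNIV gap" "continuous_on UNIV outer"
    unfolding gap_def outer_def by (intro continuous_intros)+
  have conts: "continuous_on UNIV s"
    unfolding s_def
    by (intro continuous_intros continuous_on_compose2[OF \<phi>(1)] continuous_on_compose2[OF \<psi>(1)] contg) auto
  have contF: "continuous_on UNIV F"
    unfolding F_def q_def by (intro continuous_intros conts contg) auto
  have F_nonneg: "0 \<le> F w" for w by (simp add: F_def q_def)
  have "P \<in> M" using A1 A2 interior_subset[of C1] interior_subset[of C2] by (auto simp: P_def M_def)
  have FP: "F P = \<rho>\<^sup>2" using real_sqrt_abs[of "\<rho>\<^sup>2"] by (simp add: F_def P_def s_def q_def gap_def outer_def)
  have "closed M" unfolding M_def using A1(2) A2(2) by (rule closed_Times)
  from ekeland[OF this continuous_on_subset[OF contF subset_UNIV] F_nonneg \<rho>(1) \<open>P \<in> M\<close>]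
  obtain Q where Q: "Q \<in> M" "F Q + \<rho> * dist Q P \<le> F P" "\<And>w. w \<in> M \<Longrightarrow> F Q \<le> F w + \<rho> * dist Q w"
    by blast
  obtain x' y1 y2 z' where Q_eq: "Q = ((x', y1), (y2, z'))" by (metis surj_pair)
  have QA: "(x', y1) \<in> A1" "(y2, z') \<in> A2" using Q(1) by (auto simp: Q_eq M_def)
  have "\<rho> * dist Q P \<le> \<rho> * \<rho>" using Q(2) FP F_nonneg[of Q] by (simp add: power2_eq_square)
  then have distQ: "dist Q P \<le> \<rho>" using \<rho>(1) by simp
  have d: "dist (x', y1) (x, y) \<le> \<rho>" "dist (y2, z') (y, z) \<le> \<rho>"
    using distQ dist_fst_le[of Q P] dist_snd_le[of Q P] by (auto simp: Q_eq P_def)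
  then have dx: "dist x' x \<le> \<rho>" and dz: "dist z' z \<le> \<rho>"
    using dist_fst_le[of "(x', y1)" "(x, y)"] dist_snd_le[of "(y2, z')" "(y, z)"] by auto
  have douter: "dist (x', z') (x, z) \<le> \<rho>"
    using norm_outer_le[of "Q - P"] distQ by (simp add: Q_eq P_def dist_norm)

  have FQ: "F Q > 0"
  proof (rule ccontr)
    assume "\<not> F Q > 0"
    then have "F Q = 0" using F_nonneg[of Q] by simp
    then have "(max (s Q) 0)\<^sup>2 + 2 * q Q = 0" by (simp add: F_def)
    moreover have "0 \<le> q Q" by (simp add: q_def)
    ultimately have "(max (s Q) 0)\<^sup>2 = 0" "q Q = 0"
      using zero_le_power2[of "max (s Q) 0"] by linarith+
    then have "s Q \<le> 0" "y1 = y2" by (simp_all add: q_def gap_def Q_eq max_def split: if_splits)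
    then have "(x', z') \<in> A1 O A2" using QA by auto
    moreover have "dist (x', z') (x, z) < d3" using douter \<rho> by simp
    ultimately have "blinfun_apply (dual_pair xd (- zd)) ((x', z') - (x, z)) \<le> (\<epsilon> + \<eta>) * norm ((x', z') - (x, z))"
      by (rule d3(2))
    then have 1: "blinfun_apply xd (x' - x) - blinfun_apply zd (z' - z) \<le> (\<epsilon> + \<eta>) * norm (x' - x, z' - z)"
      by (simp add: uminus_blinfun.rep_eq)
    have "blinfun_apply (g x - xd) (x' - x) \<le> norm (g x - xd) * norm (x' - x)"
      by (rule blinfun_apply_le_norm)
    also have "\<dots> \<le> \<eta> * norm (x' - x, z' - z)"
      using \<phi>(5,6) \<eta> by (intro mult_mono norm_fst_le[of "x' - x" "z' - z", simplified]) (auto simp: norm_prod_def)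
    finally have 2: "blinfun_apply (g x) (x' - x) \<le> blinfun_apply xd (x' - x) + \<eta> * norm (x' - x, z' - z)"
      by (simp add: minus_blinfun.rep_eq)
    have "blinfun_apply (h z - (- zd)) (z' - z) \<le> norm (h z - (- zd)) * norm (z' - z)"
      by (rule blinfun_apply_le_norm)
    also have "\<dots> \<le> \<eta> * norm (x' - x, z' - z)"
      using \<psi>(6)[of z] \<psi>(5) \<eta> by (intro mult_mono) (auto simp: norm_prod_def)
    finally have 3: "blinfun_apply (h z) (z' - z) \<le> - blinfun_apply zd (z' - z) + \<eta> * norm (x' - x, z' - z)"
      by (simp add: plus_blinfun.rep_eq)
    have "\<rho>\<^sup>2 \<le> s Q"
      using \<phi>(3)[of x x'] \<psi>(3)[of z z'] 1 2 3
      by (simp add: s_def Q_eq outer_def \<kappa>_def algebra_simps)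
    with \<open>s Q \<le> 0\<close> zero_less_power[OF \<rho>(1), of 2] show False by linarith
  qed
  define \<tau> where "\<tau> = max (s Q) 0 / F Q"
  define us where "us = \<tau> *\<^sub>R g x'"
  define vs where "vs = inverse (F Q) *\<^sub>R duality_sel (y1 - y2)"
  define zs where "zs = - (\<tau> *\<^sub>R h z')"
  have \<tau>: "\<tau> \<ge> 0" using FQ by (simp add: \<tau>_def)
  have norm1: "\<tau>\<^sup>2 + (norm vs)\<^sup>2 = 1"
  proof -
    have "(F Q)\<^sup>2 = (max (s Q) 0)\<^sup>2 + (norm (y1 - y2))\<^sup>2"
      by (simp add: F_def q_def gap_def Q_eq)
    moreover have "\<tau>\<^sup>2 + (norm vs)\<^sup>2 = ((max (s Q) 0)\<^sup>2 + (norm (y1 - y2))\<^sup>2) / (F Q)\<^sup>2"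
      using FQ by (simp add: \<tau>_def vs_def power_divide power_mult_distrib field_simps)
    ultimately have "\<tau>\<^sup>2 + (norm vs)\<^sup>2 = (F Q)\<^sup>2 / (F Q)\<^sup>2" by (simp only:)
    then show ?thesis using FQ by simp
  qed
  then have "\<tau>\<^sup>2 \<le> 1\<^sup>2" using zero_le_power2[of "norm vs"] unfolding one_power2 by linarith
  then have \<tau>1: "\<tau> \<le> 1" by (rule power2_le_imp_le) simp

  have "- (inverse (F Q) *\<^sub>R (max (s Q) 0 *\<^sub>R H Q + G Q)) \<in> eps_normals (\<kappa> * (max (s Q) 0 / F Q) + \<rho>) Q (A1 \<times> A2)"
    unfolding F_def
  proof (rule penalty_minimizer_normal, unfold F_def[symmetric])
    show "s w - s Q \<le> blinfun_apply (H w) (w - Q) + \<kappa> * norm (w - Q)" for w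
    proof -
      have "norm (outer w - (x, z)) - norm (outer Q - (x, z)) \<le> norm (outer (w - Q))"
        using norm_triangle_ineq2[of "outer w - (x, z)" "outer Q - (x, z)"] by (simp add: outer_def)
      also have "\<dots> \<le> norm (w - Q)" unfolding outer_def by (rule norm_outer_le)
      finally have "\<kappa> * norm (outer w - (x, z)) - \<kappa> * norm (outer Q - (x, z)) \<le> \<kappa> * norm (w - Q)"
        using \<kappa> by (simp add: mult_left_mono flip: right_diff_distrib)
      then show ?thesis
        using \<phi>(3)[of "fst (fst w)" "fst (fst Q)"] \<psi>(3)[of "snd (snd w)" "snd (snd Q)"]
        by (simp add: s_def H_def uminus_blinfun.rep_eq blinfun.diff_right)
    qed
    show "isCont s Q" using conts continuous_on_interior[of UNIV s Q] by simp
    show "isCont H Q" unfolding H_def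
      by (intro isCont_dual_pair continuous_intros isCont_o2[OF _ \<phi>(2)] isCont_o2[OF _ \<psi>(2)])
    have "isCont gap Q" using contg(1) continuous_on_interior[of UNIV gap Q] by simp
    then show "isCont G Q" unfolding G_def
      by (intro isCont_dual_pair continuous_intros isCont_o2[OF _ isCont_duality_sel[OF luc(2)]])
    show "q w - q Q \<le> blinfun_apply (G w) (w - Q)" for w
      using duality_map_subgradient[OF duality_sel[of "gap w"], of "gap Q"]
      by (simp add: q_def G_def gap_def uminus_blinfun.rep_eq blinfun.diff_right)
    show "0 \<le> q w" for w by (simp add: q_def)
    show "Q \<in> A1 \<times> A2" using QA by (simp add: Q_eq)
    show "F Q > 0" by (rule FQ)
    show "\<rho> > 0" by (rule \<rho>(1))
    show "F Q \<le> F w + \<rho> * dist w Q" if w: "w \<in> A1 \<times> A2" "dist w Q < \<rho>" for w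
    proof -
      have "dist w P < 2 * \<rho>" using dist_triangle[of w P Q] distQ w(2) by simp
      then have "dist (fst w) (x, y) < r1" "dist (snd w) (y, z) < r2"
        using dist_fst_le[of w P] dist_snd_le[of w P] \<rho> by (auto simp: P_def)
      then have "fst w \<in> C1" "snd w \<in> C2" using r1(2) r2(2) by (auto simp: dist_commute)
      with w have "w \<in> M" by (auto simp: M_def)
      with Q(3)[of w] show ?thesis by (simp add: dist_commute)
    qed
  qed
  also have "- (inverse (F Q) *\<^sub>R (max (s Q) 0 *\<^sub>R H Q + G Q)) = dual_pair (dual_pair us (- vs)) (dual_pair vs (- zs))"
    by (rule blinfun_eqI)
      (simp add: H_def G_def Q_eq gap_def us_def vs_def zs_def \<tau>_def uminus_blinfun.rep_eq
        scaleR_blinfun.rep_eq plus_blinfun.rep_eq minus_blinfun.rep_eq divide_inverse algebra_simps)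
  finally have "dual_pair (dual_pair us (- vs)) (dual_pair vs (- zs)) \<in> eps_normals (\<epsilon> + 4 * \<eta>) Q (A1 \<times> A2)"
  proof (rule eps_normals_mono)
    have "\<kappa> * \<tau> \<le> \<kappa> * 1" using \<kappa> \<tau>1 by (intro mult_left_mono)
    then show "\<kappa> * (max (s Q) 0 / F Q) + \<rho> \<le> \<epsilon> + 4 * \<eta>" using \<rho>(7) by (simp add: \<tau>_def \<kappa>_def)
  qed
  then have normals: "dual_pair us (- vs) \<in> eps_normals (\<epsilon> + 4 * \<eta>) (x', y1) A1"
    "dual_pair vs (- zs) \<in> eps_normals (\<epsilon> + 4 * \<eta>) (y2, z') A2"
    unfolding Q_eq by (rule eps_normals_Times)+
  have cone: "c *\<^sub>R f \<in> (\<Union>u\<in>contingent_cone w D. duality_map u)"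
    if f: "f \<in> (\<Union>u\<in>contingent_cone w D. duality_map u)" and "c \<ge> 0" for c f and w :: "'w::real_normed_vector" and D
  proof -
    obtain u where "u \<in> contingent_cone w D" "f \<in> duality_map u" using f by blast
    then have "c *\<^sub>R u \<in> contingent_cone w D" "c *\<^sub>R f \<in> duality_map (c *\<^sub>R u)"
      using \<open>c \<ge> 0\<close> by (simp_all add: contingent_cone_scaleR duality_map_scaleR)
    then show ?thesis by blast
  qed
  have us: "us \<in> (\<Union>u\<in>contingent_cone x' \<Omega>. duality_map u)"
    unfolding us_def using QA(1) \<Omega>(2) \<phi>(4)[of x'] \<tau> by (intro cone) auto
  have zs: "- zs \<in> (\<Union>u\<in>contingent_cone z' \<Theta>. duality_map u)"
    unfolding zs_def minus_minus using QA(2) \<Theta>(2) \<psi>(4)[of z'] \<tau> by (intro cone) auto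
  have vs: "vs = duality_sel (inverse (F Q) *\<^sub>R (y1 - y2))" "- vs = duality_sel ((- inverse (F Q)) *\<^sub>R (y1 - y2))"
    unfolding duality_sel_scaleR[OF luc(2)] by (simp_all add: vs_def)
  have scaled: "norm (\<tau> *\<^sub>R f) \<le> \<eta>" if "norm f \<le> \<eta>" for f :: "'w::real_normed_vector"
    using mult_mono[OF \<tau>1 that] \<tau> by simp
  have "norm (us - \<tau> *\<^sub>R xd) \<le> \<eta>"
    using scaled[OF \<phi>(6)[of x']] dx \<rho>(4) by (simp add: us_def scaleR_diff_right)
  moreover have "norm (zs - \<tau> *\<^sub>R zd) \<le> \<eta>"
  proof -
    have "zs - \<tau> *\<^sub>R zd = - (\<tau> *\<^sub>R (h z' - (- zd)))" by (simp add: zs_def algebra_simps)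
    then show ?thesis using scaled[OF \<psi>(6)[of z']] dz \<rho>(5) by (simp only: norm_minus_cancel)
  qed
  moreover have "dist (x', y1) (x, y) \<le> \<eta>" "dist (y2, z') (y, z) \<le> \<eta>" using d \<rho>(7) by simp_all
  ultimately show ?thesis using \<tau> norm1 QA normals us zs vs by blast
qed

section \<open>Stability of the PSNC property under composition\<close>

lemma gph_mf_restrict_comp:
  "gph (mf_restrict (mf_comp S2 S1) \<Omega> \<Theta>) = gph (mf_restrict S1 \<Omega> UNIV) O gph (mf_restrict S2 UNIV \<Theta>)"
  by (auto simp: gph_def mf_restrict_def mf_comp_def relcomp_unfold split: if_splits)

lemma rel_normal_seqs_subseq:
  assumes "rel_normal_seqs S \<Omega> \<Theta> x y \<epsilon> xs ys xd yd" and r: "strict_mono r"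
  shows "rel_normal_seqs S \<Omega> \<Theta> x y (\<lambda>k. \<epsilon> (r k)) (\<lambda>k. xs (r k)) (\<lambda>k. ys (r k)) (\<lambda>k. xd (r k)) (\<lambda>k. yd (r k))"
proof -
  have "\<epsilon> \<longlonglongrightarrow> 0" "(\<lambda>k. (xs k, ys k)) \<longlonglongrightarrow> (x, y)"
    using assms(1) by (simp_all add: rel_normal_seqs_def)
  from this[THEN LIMSEQ_subseq_LIMSEQ, OF r] show ?thesis
    using assms(1) by (simp add: rel_normal_seqs_def o_def)
qed

lemma weak_star_tendsto_subseq:
  assumes "weak_star_tendsto f l" and "strict_mono r"
  shows "weak_star_tendsto (\<lambda>k. f (r k)) l"
  unfolding weak_star_tendsto_def
proof
  fix u
  have "(\<lambda>k. blinfun_apply (f k) u) \<longlonglongrightarrow> blinfun_apply l u"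
    using assms(1) by (simp add: weak_star_tendsto_def)
  from LIMSEQ_subseq_LIMSEQ[OF this assms(2)]
  show "(\<lambda>k. blinfun_apply (f (r k)) u) \<longlonglongrightarrow> blinfun_apply l u" by (simp add: o_def)
qed

lemma weak_star_tendsto_zero_perturb:
  fixes u f :: "nat \<Rightarrow> 'a::real_normed_vector dual" and c :: "nat \<Rightarrow> real"
  assumes f: "weak_star_tendsto f 0" and c: "\<And>k. \<bar>c k\<bar> \<le> 1"
    and e: "\<And>k. norm (u k - c k *\<^sub>R f k) \<le> e k" "e \<longlonglongrightarrow> 0"
  shows "weak_star_tendsto u 0"
  unfolding weak_star_tendsto_def
proof
  fix x
  have "(\<lambda>k. blinfun_apply (u k) x) \<longlonglongrightarrow> 0"
  proof (rule Lim_null_comparison)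
    show "\<forall>\<^sub>F k in sequentially. norm (blinfun_apply (u k) x) \<le> e k * norm x + \<bar>blinfun_apply (f k) x\<bar>"
    proof (intro always_eventually allI)
      fix k
      have "norm (blinfun_apply (u k - c k *\<^sub>R f k) x) \<le> norm (u k - c k *\<^sub>R f k) * norm x"
        by (rule norm_blinfun)
      also have "\<dots> \<le> e k * norm x" by (intro mult_right_mono e(1)) simp
      finally have "norm (blinfun_apply (u k - c k *\<^sub>R f k) x) \<le> e k * norm x" .
      moreover have "\<bar>c k * blinfun_apply (f k) x\<bar> \<le> \<bar>blinfun_apply (f k) x\<bar>"
        unfolding abs_mult using c[of k] by (intro mult_left_le_one_le) auto
      ultimately show "norm (blinfun_apply (u k) x) \<le> e k * norm x + \<bar>blinfun_apply (f k) x\<bar>"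
        by (simp add: minus_blinfun.rep_eq scaleR_blinfun.rep_eq)
    qed
    have "(\<lambda>k. blinfun_apply (f k) x) \<longlonglongrightarrow> 0" using f by (simp add: weak_star_tendsto_def)
    then show "(\<lambda>k. e k * norm x + \<bar>blinfun_apply (f k) x\<bar>) \<longlonglongrightarrow> 0"
      by (intro tendsto_add_zero tendsto_mult_left_zero tendsto_rabs_zero e(2))
  qed
  then show "(\<lambda>k. blinfun_apply (u k) x) \<longlonglongrightarrow> blinfun_apply 0 x" by simp
qed

lemma normal_coderivativeI:
  assumes "(x, y) \<in> gph (mf_restrict S \<Omega> \<Theta>)" and "rel_normal_seqs S \<Omega> \<Theta> x y \<epsilon> xs ys xd yd"
    and "weak_star_tendsto xd xd0" and "weak_star_tendsto yd yd0"
  shows "xd0 \<in> normal_coderivative S \<Omega> \<Theta> x y yd0"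
  unfolding normal_coderivative_def
  by (intro CollectI conjI assms(1) exI[of _ \<epsilon>] exI[of _ xs] exI[of _ ys] exI[of _ xd] exI[of _ yd])
    (fact assms)+

lemma mixed_coderivativeI:
  assumes "(x, y) \<in> gph (mf_restrict S \<Omega> \<Theta>)" and "rel_normal_seqs S \<Omega> \<Theta> x y \<epsilon> xs ys xd yd"
    and "weak_star_tendsto xd xd0" and "yd \<longlonglongrightarrow> yd0"
  shows "xd0 \<in> mixed_coderivative S \<Omega> \<Theta> x y yd0"
  unfolding mixed_coderivative_def
  by (intro CollectI conjI assms(1) exI[of _ \<epsilon>] exI[of _ xs] exI[of _ ys] exI[of _ xd] exI[of _ yd])
    (fact assms)+

lemma PSNC_graph: "PSNC S \<Omega> \<Theta> x y \<Longrightarrow> (x, y) \<in> gph (mf_restrict S \<Omega> \<Theta>)"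
  by (simp add: PSNC_def)

lemma PSNC_tendsto_zero:
  assumes "PSNC S \<Omega> \<Theta> x y" and "rel_normal_seqs S \<Omega> \<Theta> x y \<epsilon> xs ys xd yd"
    and "\<And>k. \<epsilon> k < 1" and "weak_star_tendsto xd 0" and "yd \<longlonglongrightarrow> 0"
  shows "xd \<longlonglongrightarrow> 0"
proof -
  have "(\<lambda>k. norm (xd k)) \<longlonglongrightarrow> 0"
    using assms(1)[unfolded PSNC_def, THEN conjunct2, THEN spec[of _ \<epsilon>], THEN spec[of _ xs],
        THEN spec[of _ ys], THEN spec[of _ xd], THEN spec[of _ yd]] assms(2-5) by simp
  then show ?thesis by (rule tendsto_norm_zero_cancel)
qed

text \<open>A weak* cluster point \<open>v\<close> of the intermediate functionals satisfies both membership conditions of the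
  qualification condition, hence \<open>v = 0\<close>; the PSNC property of the outer map then turns
  weak* convergence into norm convergence.\<close>

lemma intermediate_duals_tendsto_zero:
  fixes S1 :: "('x::real_normed_vector, 'y::real_normed_vector) multifun"
    and S2 :: "('y, 'z::real_normed_vector) multifun"
  assumes refl: "reflexive TYPE('y)"
    and xy: "(x, y) \<in> gph (mf_restrict S1 \<Omega> UNIV)"
    and psnc: "PSNC S2 UNIV \<Theta> y z"
    and qual: "mixed_coderivative S2 UNIV \<Theta> y z 0 \<inter> mf_kernel (normal_coderivative S1 \<Omega> UNIV x y) \<subseteq> {0}"
    and rel1: "rel_normal_seqs S1 \<Omega> UNIV x y \<epsilon> xs ys us vs"
    and rel2: "rel_normal_seqs S2 UNIV \<Theta> y z \<epsilon> ys' zs vs ws"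
    and \<epsilon>: "\<And>k. \<epsilon> k < 1" and us: "weak_star_tendsto us 0" and ws: "ws \<longlonglongrightarrow> 0"
    and bound: "\<And>k. norm (vs k) \<le> B"
  shows "vs \<longlonglongrightarrow> 0"
proof (rule ccontr)
  assume "\<not> vs \<longlonglongrightarrow> 0"
  then obtain e where e: "e > 0" "\<forall>N. \<exists>n\<ge>N. \<not> norm (vs n) < e"
    unfolding LIMSEQ_iff diff_zero by blast
  define D where "D = {n. \<not> norm (vs n) < e}"
  have "infinite D" using e(2) by (simp add: D_def infinite_nat_iff_unbounded_le)
  then obtain r :: "nat \<Rightarrow> nat" where r: "strict_mono r" "\<forall>k. r k \<in> D"
    using infinite_enumerate by blast
  obtain r' v where r': "strict_mono r'" and v: "weak_star_tendsto (\<lambda>k. vs (r (r' k))) v"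
    using reflexive_weak_star_subsequence[where v = "\<lambda>k. vs (r k)" and B = B, OF refl bound] .
  define p where "p = (\<lambda>k. r (r' k))"
  have p: "strict_mono p" using strict_mono_o[OF r(1) r'] by (simp add: p_def o_def)
  note sub1 = rel_normal_seqs_subseq[OF rel1 p] and sub2 = rel_normal_seqs_subseq[OF rel2 p]
  have vp: "weak_star_tendsto (\<lambda>k. vs (p k)) v" using v by (simp add: p_def)
  have wp: "(\<lambda>k. ws (p k)) \<longlonglongrightarrow> 0" using LIMSEQ_subseq_LIMSEQ[OF ws p] by (simp add: o_def)
  have "0 \<in> normal_coderivative S1 \<Omega> UNIV x y v"
    by (rule normal_coderivativeI[OF xy sub1 weak_star_tendsto_subseq[OF us p] vp])
  moreover have "v \<in> mixed_coderivative S2 UNIV \<Theta> y z 0"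
    by (rule mixed_coderivativeI[OF PSNC_graph[OF psnc] sub2 vp wp])
  ultimately have "v = 0" using qual by (auto simp: mf_kernel_def)
  with vp have "weak_star_tendsto (\<lambda>k. vs (p k)) 0" by simp
  from PSNC_tendsto_zero[OF psnc sub2 \<epsilon> this wp] have "(\<lambda>k. norm (vs (p k))) \<longlonglongrightarrow> 0"
    by (rule tendsto_norm_zero)
  from order_tendstoD(2)[OF this e(1)] obtain k where "norm (vs (p k)) < e"
    unfolding eventually_sequentially by blast
  then show False using spec[OF r(2), of "r' k"] by (simp add: p_def D_def)
qed

theorem proposition4p5:
  fixes S1 :: "('x::banach, 'y::banach) multifun"
    and S2 :: "('y, 'z::banach) multifun"
    and S :: "('x, 'z) multifun"
    and G :: "('x \<times> 'z, 'y) multifun"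
    and \<Omega> :: "'x set" and \<Theta> :: "'z set"
    and x :: 'x and y :: 'y and z :: 'z
  assumes "reflexive_banach_space TYPE('x)"
    and "reflexive_banach_space TYPE('y)"
    and "reflexive_banach_space TYPE('z)"
    and "closed \<Omega>" and "convex \<Omega>"
    and "closed \<Theta>" and "convex \<Theta>"
    and S_def: "S = mf_comp S2 S1"
    and G_def: "G = (\<lambda>(u, w). S1 u \<inter> mf_inverse S2 w)"
    and "(x, z) \<in> gph (mf_restrict S \<Omega> \<Theta>)"
    and "y \<in> G (x, z)"
    and "closed_around (gph (mf_restrict S1 \<Omega> UNIV)) (x, y)"
    and "closed_around (gph (mf_restrict S2 UNIV \<Theta>)) (y, z)"
    and "inner_semicontinuous_rel G (\<Omega> \<times> \<Theta>) (x, z) y"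
    and "PSNC S1 \<Omega> UNIV x y"
    and "PSNC S2 UNIV \<Theta> y z"
    and "mixed_coderivative S2 UNIV \<Theta> y z 0 \<inter>
           mf_kernel (normal_coderivative S1 \<Omega> UNIV x y) = {0}"
  shows "PSNC S \<Omega> \<Theta> x z"
  unfolding PSNC_def
proof (intro conjI allI impI, fact)
  fix \<epsilon> xs zs xd zd
  assume "rel_normal_seqs S \<Omega> \<Theta> x z \<epsilon> xs zs xd zd \<and> (\<forall>k. \<epsilon> k < 1) \<and> weak_star_tendsto xd 0 \<and> zd \<longlonglongrightarrow> 0"
  then have rel: "rel_normal_seqs S \<Omega> \<Theta> x z \<epsilon> xs zs xd zd"
    and xd: "weak_star_tendsto xd 0" and zd: "zd \<longlonglongrightarrow> 0" by auto
  define A1 where "A1 = gph (mf_restrict S1 \<Omega> UNIV)"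
  define A2 where "A2 = gph (mf_restrict S2 UNIV \<Theta>)"
  have gph_S: "gph (mf_restrict S \<Omega> \<Theta>) = A1 O A2"
    by (simp add: S_def A1_def A2_def gph_mf_restrict_comp)
  have \<epsilon>: "\<And>k. \<epsilon> k > 0" "\<epsilon> \<longlonglongrightarrow> 0"
    and graph: "\<And>k. (xs k, zs k) \<in> gph (mf_restrict S \<Omega> \<Theta>)"
    and lim: "(\<lambda>k. (xs k, zs k)) \<longlonglongrightarrow> (x, z)"
    and N: "\<And>k. dual_pair (xd k) (- zd k) \<in> eps_normals (\<epsilon> k) (xs k, zs k) (A1 O A2)"
    and Jx: "\<And>k. xd k \<in> (\<Union>u\<in>contingent_cone (xs k) \<Omega>. duality_map u)"
    and Jz: "\<And>k. - zd k \<in> (\<Union>v\<in>contingent_cone (zs k) \<Theta>. duality_map v)"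
    using rel unfolding rel_normal_seqs_def gph_S by auto
  have luc: "locally_uniformly_convex TYPE('x dual)" "locally_uniformly_convex TYPE('y dual)"
      "locally_uniformly_convex TYPE('z dual)" and refl: "reflexive TYPE('y)"
    using assms(1-3) by (simp_all add: reflexive_banach_space_def)

  have "(xs k, zs k) \<in> \<Omega> \<times> \<Theta> \<and> G (xs k, zs k) \<noteq> {}" for k
    using graph[of k] by (auto simp: S_def G_def gph_def mf_restrict_def mf_comp_def mf_inverse_def split: if_splits)
  then obtain ys where ys: "\<And>k. ys k \<in> G (xs k, zs k)" "ys \<longlonglongrightarrow> y"
    using \<open>inner_semicontinuous_rel G (\<Omega> \<times> \<Theta>) (x, z) y\<close> lim
    unfolding inner_semicontinuous_rel_def by blast
  have A: "(xs k, ys k) \<in> A1" "(ys k, zs k) \<in> A2" for k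
    using graph[of k] ys(1)[of k]
    by (auto simp: A1_def A2_def G_def gph_def mf_restrict_def mf_inverse_def split: if_splits)
  have xs: "xs \<longlonglongrightarrow> x" and zs: "zs \<longlonglongrightarrow> z"
    using tendsto_fst[OF lim] tendsto_snd[OF lim] by simp_all
  have lim1: "(\<lambda>k. (xs k, ys k)) \<longlonglongrightarrow> (x, y)" and lim2: "(\<lambda>k. (ys k, zs k)) \<longlonglongrightarrow> (y, z)"
    by (intro tendsto_Pair xs ys zs)+
  obtain C1 where C1: "closed (A1 \<inter> C1)" "(x, y) \<in> interior C1"
    using \<open>closed_around (gph (mf_restrict S1 \<Omega> UNIV)) (x, y)\<close> unfolding closed_around_def A1_def by blast
  obtain C2 where C2: "closed (A2 \<inter> C2)" "(y, z) \<in> interior C2"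
    using \<open>closed_around (gph (mf_restrict S2 UNIV \<Theta>)) (y, z)\<close> unfolding closed_around_def A2_def by blast
  define \<eta> where "\<eta> k = inverse (real (Suc k))" for k
  have \<eta>: "\<eta> k > 0" "\<eta> \<longlonglongrightarrow> 0" for k
    unfolding \<eta>_def by (simp, rule LIMSEQ_inverse_real_of_nat)
  have small: "(\<lambda>k. \<epsilon> k + 4 * \<eta> k) \<longlonglongrightarrow> 0" using tendsto_add[OF \<epsilon>(2) tendsto_mult[OF tendsto_const \<eta>(2)], of 4] by simp
  have "eventually (\<lambda>k. (xs k, ys k) \<in> interior C1 \<and> (ys k, zs k) \<in> interior C2 \<and> \<epsilon> k + 4 * \<eta> k < 1) sequentially"
    by (intro eventually_conj topological_tendstoD[OF lim1] topological_tendstoD[OF lim2] order_tendstoD(2)[OF small]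
        C1 C2 open_interior) simp
  then obtain K where K: "\<And>k. k \<ge> K \<Longrightarrow> (xs k, ys k) \<in> interior C1 \<and> (ys k, zs k) \<in> interior C2 \<and> \<epsilon> k + 4 * \<eta> k < 1"
    unfolding eventually_sequentially by blast
  have sub: "A1 \<subseteq> \<Omega> \<times> UNIV" "A2 \<subseteq> UNIV \<times> \<Theta>"
    by (auto simp: A1_def A2_def gph_def mf_restrict_def split: if_splits)
  \<comment> \<open>The fuzzy rule at every index from \<open>K\<close> on, with tolerance \<open>\<eta> k\<close>.\<close>
  define R where "R k \<tau> x' y1 y2 z' us vs ws \<longleftrightarrow> 0 \<le> \<tau> \<and> \<tau>\<^sup>2 + (norm vs)\<^sup>2 = 1 \<and>
    (x', y1) \<in> A1 \<and> dist (x', y1) (xs (k + K), ys (k + K)) \<le> \<eta> (k + K) \<and>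
    (y2, z') \<in> A2 \<and> dist (y2, z') (ys (k + K), zs (k + K)) \<le> \<eta> (k + K) \<and>
    dual_pair us (- vs) \<in> eps_normals (\<epsilon> (k + K) + 4 * \<eta> (k + K)) (x', y1) A1 \<and>
    dual_pair vs (- ws) \<in> eps_normals (\<epsilon> (k + K) + 4 * \<eta> (k + K)) (y2, z') A2 \<and>
    us \<in> (\<Union>u\<in>contingent_cone x' \<Omega>. duality_map u) \<and>
    - ws \<in> (\<Union>u\<in>contingent_cone z' \<Theta>. duality_map u) \<and>
    vs \<in> range duality_sel \<and> - vs \<in> range duality_sel \<and>
    norm (us - \<tau> *\<^sub>R xd (k + K)) \<le> \<eta> (k + K) \<and> norm (ws - \<tau> *\<^sub>R zd (k + K)) \<le> \<eta> (k + K)"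
    for k \<tau> x' y1 y2 z' us vs ws
  have "\<exists>\<tau> x' y1 y2 z' us vs ws. R k \<tau> x' y1 y2 z' us vs ws" for k
  proof -
    have "K \<le> k + K" by simp
    note Kk = K[OF this]
    show ?thesis
      unfolding R_def
      by (rule fuzzy_relcomp_normals[OF luc \<open>convex \<Omega>\<close> sub(1) \<open>convex \<Theta>\<close> sub(2) A(1) C1(1) _ A(2) C2(1) _ N _ Jx Jz \<eta>(1)])
        (use Kk \<epsilon>(1)[of "k + K"] in auto)
  qed
  then have "\<forall>k. \<exists>\<tau> x' y1 y2 z' us vs ws. R k \<tau> x' y1 y2 z' us vs ws" ..
  then obtain T X Y1 Y2 Z U V W where R: "R k (T k) (X k) (Y1 k) (Y2 k) (Z k) (U k) (V k) (W k)" for k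
    unfolding choice_iff by (elim exE) blast
  have
    T: "\<And>k. 0 \<le> T k" "\<And>k. (T k)\<^sup>2 + (norm (V k))\<^sup>2 = 1"
    and XY: "\<And>k. (X k, Y1 k) \<in> A1" "\<And>k. dist (X k, Y1 k) (xs (k + K), ys (k + K)) \<le> \<eta> (k + K)"
    and YZ: "\<And>k. (Y2 k, Z k) \<in> A2" "\<And>k. dist (Y2 k, Z k) (ys (k + K), zs (k + K)) \<le> \<eta> (k + K)"
    and N1: "\<And>k. dual_pair (U k) (- V k) \<in> eps_normals (\<epsilon> (k + K) + 4 * \<eta> (k + K)) (X k, Y1 k) A1"
    and N2: "\<And>k. dual_pair (V k) (- W k) \<in> eps_normals (\<epsilon> (k + K) + 4 * \<eta> (k + K)) (Y2 k, Z k) A2"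
    and JU: "\<And>k. U k \<in> (\<Union>u\<in>contingent_cone (X k) \<Omega>. duality_map u)"
    and JW: "\<And>k. - W k \<in> (\<Union>u\<in>contingent_cone (Z k) \<Theta>. duality_map u)"
    and JV: "\<And>k. V k \<in> range duality_sel" "\<And>k. - V k \<in> range duality_sel"
    and UT: "\<And>k. norm (U k - T k *\<^sub>R xd (k + K)) \<le> \<eta> (k + K)"
    and WT: "\<And>k. norm (W k - T k *\<^sub>R zd (k + K)) \<le> \<eta> (k + K)"
    using R by (simp_all add: R_def)
  define \<epsilon>' where "\<epsilon>' = (\<lambda>k. \<epsilon> (k + K) + 4 * \<eta> (k + K))"
  have \<epsilon>': "\<And>k. \<epsilon>' k > 0" "\<And>k. \<epsilon>' k < 1" "\<epsilon>' \<longlonglongrightarrow> 0"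
    unfolding \<epsilon>'_def
    using \<epsilon>(1) \<eta>(1) K LIMSEQ_ignore_initial_segment[OF small, of K] by (auto intro!: add_pos_pos)
  have \<eta>K: "(\<lambda>k. \<eta> (k + K)) \<longlonglongrightarrow> 0" by (rule LIMSEQ_ignore_initial_segment[OF \<eta>(2)])
  have near: "f \<longlonglongrightarrow> l" if fg: "\<And>k. dist (f k) (g (k + K)) \<le> \<eta> (k + K)" and g: "g \<longlonglongrightarrow> l"
    for f g :: "nat \<Rightarrow> 'w::metric_space" and l
  proof -
    have "(\<lambda>k. \<eta> (k + K) + dist (g (k + K)) l) \<longlonglongrightarrow> 0 + dist l l"
      by (intro tendsto_add tendsto_dist tendsto_const \<eta>K LIMSEQ_ignore_initial_segment[OF g])
    then have bound_lim: "(\<lambda>k. \<eta> (k + K) + dist (g (k + K)) l) \<longlonglongrightarrow> 0" by simp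
    have "dist (f k) l \<le> \<eta> (k + K) + dist (g (k + K)) l" for k
      using dist_triangle[of "f k" l "g (k + K)"] fg[of k] by simp
    then have "(\<lambda>k. dist (f k) l) \<longlonglongrightarrow> 0"
      by (intro Lim_null_comparison[OF _ bound_lim] always_eventually allI) simp
    then show ?thesis by (rule iffD2[OF tendsto_dist_iff])
  qed
  have range_J: "f \<in> (\<Union>v\<in>contingent_cone w UNIV. duality_map v)" if "f \<in> range duality_sel"
    for f and w :: "'w::real_normed_vector"
    using that duality_sel by auto
  have rel1: "rel_normal_seqs S1 \<Omega> UNIV x y \<epsilon>' X Y1 U V"
    unfolding rel_normal_seqs_def A1_def[symmetric]
    using \<epsilon>' XY(1) near[OF XY(2) lim1] N1 JU range_J[OF JV(2)] by (auto simp: \<epsilon>'_def)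
  have rel2: "rel_normal_seqs S2 UNIV \<Theta> y z \<epsilon>' Y2 Z V W"
    unfolding rel_normal_seqs_def A2_def[symmetric]
    using \<epsilon>' YZ(1) near[OF YZ(2) lim2] N2 JW range_J[OF JV(1)] by (auto simp: \<epsilon>'_def)
  have T1: "\<bar>T k\<bar> \<le> 1" and V1: "norm (V k) \<le> 1" for k
  proof -
    have "(T k)\<^sup>2 \<le> 1\<^sup>2" "(norm (V k))\<^sup>2 \<le> 1\<^sup>2"
      using T(2)[of k] zero_le_power2[of "T k"] zero_le_power2[of "norm (V k)"] unfolding one_power2 by linarith+
    then show "\<bar>T k\<bar> \<le> 1" "norm (V k) \<le> 1" using T(1)[of k] power2_le_imp_le[of "T k" 1] power2_le_imp_le[of "norm (V k)" 1] by simp_all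
  qed
  have "weak_star_tendsto (\<lambda>k. xd (k + K)) 0"
    unfolding weak_star_tendsto_def
  proof
    fix u
    have "(\<lambda>k. blinfun_apply (xd k) u) \<longlonglongrightarrow> blinfun_apply 0 u" using xd by (simp add: weak_star_tendsto_def)
    then show "(\<lambda>k. blinfun_apply (xd (k + K)) u) \<longlonglongrightarrow> blinfun_apply 0 u"
      by (rule LIMSEQ_ignore_initial_segment)
  qed
  from weak_star_tendsto_zero_perturb[OF this T1 UT \<eta>K] have U0: "weak_star_tendsto U 0" .
  have W0: "W \<longlonglongrightarrow> 0"
  proof (rule Lim_null_comparison)
    show "\<forall>\<^sub>F k in sequentially. norm (W k) \<le> \<eta> (k + K) + norm (zd (k + K))"
    proof (intro always_eventually allI)
      fix k
      have "norm (T k *\<^sub>R zd (k + K)) \<le> norm (zd (k + K))" using T1[of k] by (simp add: mult_left_le_one_le)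
      then show "norm (W k) \<le> \<eta> (k + K) + norm (zd (k + K))"
        using WT[of k] norm_triangle_sub[of "W k" "T k *\<^sub>R zd (k + K)"] by simp
    qed
    show "(\<lambda>k. \<eta> (k + K) + norm (zd (k + K))) \<longlonglongrightarrow> 0"
      using tendsto_add[OF \<eta>K tendsto_norm[OF LIMSEQ_ignore_initial_segment[OF zd, of K]]] by simp
  qed
  have xy: "(x, y) \<in> gph (mf_restrict S1 \<Omega> UNIV)"
    using \<open>PSNC S1 \<Omega> UNIV x y\<close> by (rule PSNC_graph)
  have V0: "V \<longlonglongrightarrow> 0"
    by (rule intermediate_duals_tendsto_zero[OF refl xy \<open>PSNC S2 UNIV \<Theta> y z\<close> _ rel1 rel2 \<epsilon>'(2) U0 W0 V1])
      (simp add: assms(17))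
  have Un: "(\<lambda>k. norm (U k)) \<longlonglongrightarrow> 0"
    using PSNC_tendsto_zero[OF \<open>PSNC S1 \<Omega> UNIV x y\<close> rel1 \<epsilon>'(2) U0 V0] by (rule tendsto_norm_zero)
  have "(\<lambda>k. sqrt (1 - (norm (V k))\<^sup>2)) \<longlonglongrightarrow> sqrt (1 - (norm (0 :: 'y dual))\<^sup>2)"
    by (intro tendsto_intros V0)
  moreover have "sqrt (1 - (norm (V k))\<^sup>2) = T k" for k
    using T(2)[of k] T(1)[of k] by (intro real_sqrt_unique) (simp_all add: eq_diff_eq)
  ultimately have TT: "T \<longlonglongrightarrow> 1" by simp
  have "(\<lambda>k. norm (T k *\<^sub>R xd (k + K))) \<longlonglongrightarrow> 0"
  proof (rule Lim_null_comparison)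
    show "\<forall>\<^sub>F k in sequentially. norm (norm (T k *\<^sub>R xd (k + K))) \<le> norm (U k) + \<eta> (k + K)"
    proof (intro always_eventually allI)
      show "norm (norm (T k *\<^sub>R xd (k + K))) \<le> norm (U k) + \<eta> (k + K)" for k
        using UT[of k] norm_triangle_sub[of "T k *\<^sub>R xd (k + K)" "U k"] by (simp add: norm_minus_commute)
    qed
    show "(\<lambda>k. norm (U k) + \<eta> (k + K)) \<longlonglongrightarrow> 0" using tendsto_add[OF Un \<eta>K] by simp
  qed
  from tendsto_divide[OF this TT] have "(\<lambda>k. norm (T k *\<^sub>R xd (k + K)) / T k) \<longlonglongrightarrow> 0" by simp
  moreover have "\<forall>\<^sub>F k in sequentially. norm (T k *\<^sub>R xd (k + K)) / T k = norm (xd (k + K))"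
    using order_tendstoD(1)[OF TT, of 0] by (auto elim: eventually_mono)
  ultimately have "(\<lambda>k. norm (xd (k + K))) \<longlonglongrightarrow> 0" by (rule Lim_transform_eventually)
  then show "(\<lambda>k. norm (xd k)) \<longlonglongrightarrow> 0" by (rule LIMSEQ_offset)
qed

end
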